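(* Let $\mathcal{G}=(X,Y,A,B,\lambda)$ be an imitation game. Then $\mathcal{G}$ has a perfect local strategy if and only if there exists a unital *-homomorphism $\pi:C^*(\mathcal{G})\to\mathbb{C}$.
   Context: $X,Y,A,B$ are finite non-empty sets. A non-signalling game is a tuple $\mathcal{G}=(X,Y,A,B,\lambda)$ with $\lambda:X\times Y\times A\times B\to\{0,1\}$. It is an imitation game if: (1) for every $x\in X$ and $a,a'\in A$ with $a\ne a'$ there is $y\in Y$ with $\sum_{b\in B}\lambda(x,y,a,b)\lambda(x,y,a',b)=0$; and (2) for every $y\in Y$ and $b,b'\in B$ with $b\neq b'$ there is $x\in X$ with $\sum_{a\in A}\lambda(x,y,a,b)\lambda(x,y,a,b')=0$. The game C*-algebra $C^*(\mathcal{G})$ is the universal unital C*-algebra generated by projections $(p_{x,a})_{x\in X,a\in A}$ and $(q_{y,b})_{y\in Y,b\in B}$ satisfying $\sum_{a}p_{x,a}=1$ for every $x$, $\sum_{b}q_{y,b}=1$ for every $y$, and $p_{x,a}q_{y,b}=0$ whenever $\lambda(x,y,a,b)=0$. The zero C*-algebra is regarded as a unital C*-algebra (it admits no unital *-homomorphism to $\mathbb{C}$). $\mathcal{C}_{\rm loc}$ is the convex hull of the families $p(a,b|x,y)=p^1(a|x)p^2(b|y)$, where $p^1(\cdot|x)$ and $p^2(\cdot|y)$ are probability distributions on $A$ and $B$ for all $x\in X$, $y\in Y$. A perfect local strategy for $\mathcal{G}$ is an element $p\in\mathcal{C}_{\rm loc}$ such that $\lambda(x,y,a,b)=0$ implies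 $p(a,b|x,y)=0$. *)

theory Defs
  imports
    "HOL-Analysis.Analysis"
    "HOL-Algebra.QuotRing"
    "HOL-Library.Poly_Mapping"
begin

section \<open>Unital C*-algebras and unital *-homomorphisms\<close>

record 'c star_algebra = "'c ring" +
  scale :: "complex \<Rightarrow> 'c \<Rightarrow> 'c"
  adj :: "'c \<Rightarrow> 'c"
  nrm :: "'c \<Rightarrow> real"

text \<open>The locale \<^locale>\<open>ring\<close> does not require the unit to differ from zero, so the zero
  C*-algebra is included.\<close>

locale unital_cstar_algebra = ring C for C :: "('c, 'm) star_algebra_scheme" (structure) +
  assumes scale_closed: "x \<in> carrier C \<Longrightarrow> scale C c x \<in> carrier C"
    and scale_one: "x \<in> carrier C \<Longrightarrow> scale C 1 x = x"
    and scale_scale: "x \<in> carrier C \<Longrightarrow> scale C c (scale C d x) = scale C (c * d) x"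
    and scale_add_left: "x \<in> carrier C \<Longrightarrow> scale C (c + d) x = scale C c x \<oplus> scale C d x"
    and scale_add_right:
      "x \<in> carrier C \<Longrightarrow> y \<in> carrier C \<Longrightarrow> scale C c (x \<oplus> y) = scale C c x \<oplus> scale C c y"
    and scale_mult_left:
      "x \<in> carrier C \<Longrightarrow> y \<in> carrier C \<Longrightarrow> scale C c x \<otimes> y = scale C c (x \<otimes> y)"
    and scale_mult_right:
      "x \<in> carrier C \<Longrightarrow> y \<in> carrier C \<Longrightarrow> x \<otimes> scale C c y = scale C c (x \<otimes> y)"
    and adj_closed: "x \<in> carrier C \<Longrightarrow> adj C x \<in> carrier C"
    and adj_adj: "x \<in> carrier C \<Longrightarrow> adj C (adj C x) = x"
    and adj_add: "x \<in> carrier C \<Longrightarrow> y \<in> carrier C \<Longrightarrow> adj C (x \<oplus> y) = adj C x \<oplus> adj C y"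
    and adj_mult: "x \<in> carrier C \<Longrightarrow> y \<in> carrier C \<Longrightarrow> adj C (x \<otimes> y) = adj C y \<otimes> adj C x"
    and adj_scale: "x \<in> carrier C \<Longrightarrow> adj C (scale C c x) = scale C (cnj c) (adj C x)"
    and nrm_nonneg: "x \<in> carrier C \<Longrightarrow> 0 \<le> nrm C x"
    and nrm_eq_0: "x \<in> carrier C \<Longrightarrow> nrm C x = 0 \<longleftrightarrow> x = \<zero>"
    and nrm_add: "x \<in> carrier C \<Longrightarrow> y \<in> carrier C \<Longrightarrow> nrm C (x \<oplus> y) \<le> nrm C x + nrm C y"
    and nrm_scale: "x \<in> carrier C \<Longrightarrow> nrm C (scale C c x) = cmod c * nrm C x"
    and nrm_mult: "x \<in> carrier C \<Longrightarrow> y \<in> carrier C \<Longrightarrow> nrm C (x \<otimes> y) \<le> nrm C x * nrm C y"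
    and cstar_identity: "x \<in> carrier C \<Longrightarrow> nrm C (adj C x \<otimes> x) = (nrm C x)\<^sup>2"
    and complete:
      "(\<And>n. \<sigma> n \<in> carrier C) \<Longrightarrow>
       (\<And>e. 0 < e \<Longrightarrow> \<exists>N. \<forall>m\<ge>N. \<forall>n\<ge>N. nrm C (\<sigma> m \<ominus> \<sigma> n) < e) \<Longrightarrow>
       \<exists>x \<in> carrier C. (\<lambda>n. nrm C (\<sigma> n \<ominus> x)) \<longlonglongrightarrow> 0"

definition unital_star_hom ::
  "('c, 'm) star_algebra_scheme \<Rightarrow> ('d, 'n) star_algebra_scheme \<Rightarrow> ('c \<Rightarrow> 'd) set" where
  "unital_star_hom C D = {h \<in> ring_hom C D.
     (\<forall>c. \<forall>x \<in> carrier C. h (scale C c x) = scale D c (h x)) \<and>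
     (\<forall>x \<in> carrier C. h (adj C x) = adj D (h x))}"

definition complex_cstar :: "complex star_algebra" where
  "complex_cstar = \<lparr>carrier = UNIV, mult = (*), one = 1, zero = 0, add = (+),
     scale = (*), adj = cnj, nrm = cmod\<rparr>"


section \<open>The free unital *-algebra\<close>

text \<open>The free unital complex *-algebra on self-adjoint generators is the monoid algebra of the
  free monoid. The free monoid is written additively so that the convolution product of
  \<^theory>\<open>HOL-Library.Poly_Mapping\<close> is the algebra product.\<close>

datatype 'g word = Word (letters: "'g list")

instantiation word :: (type) monoid_add
begin
definition "0 = Word []"
definition "u + v = Word (letters u @ letters v)"
instance by standard (auto simp: zero_word_def plus_word_def)
end

type_synonym 'g free_alg = "'g word \<Rightarrow>\<^sub>0 complex"

definition free_gen :: "'g \<Rightarrow> 'g free_alg" where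
  "free_gen g = Poly_Mapping.single (Word [g]) 1"

definition free_scale :: "complex \<Rightarrow> 'g free_alg \<Rightarrow> 'g free_alg" where
  "free_scale c f = Poly_Mapping.map ((*) c) f"

definition word_rev :: "'g word \<Rightarrow> 'g word" where
  "word_rev w = Word (rev (letters w))"

definition free_adj :: "'g free_alg \<Rightarrow> 'g free_alg" where
  "free_adj f = Poly_Mapping.map_key word_rev (Poly_Mapping.map cnj f)"


section \<open>Universal C*-algebras\<close>

text \<open>The universal unital C*-algebra for a set of relations is the Hausdorff completion of the
  free unital *-algebra with respect to the largest C*-seminorm that annihilates the relations.\<close>

definition cstar_seminorm :: "('g free_alg \<Rightarrow> real) \<Rightarrow> bool" where
  "cstar_seminorm \<nu> \<longleftrightarrow>
     (\<forall>f. 0 \<le> \<nu> f) \<and>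
     (\<forall>f g. \<nu> (f + g) \<le> \<nu> f + \<nu> g) \<and>
     (\<forall>c f. \<nu> (free_scale c f) = cmod c * \<nu> f) \<and>
     (\<forall>f g. \<nu> (f * g) \<le> \<nu> f * \<nu> g) \<and>
     (\<forall>f. \<nu> (free_adj f * f) = (\<nu> f)\<^sup>2)"

definition admissible_seminorms :: "'g free_alg set \<Rightarrow> ('g free_alg \<Rightarrow> real) set" where
  "admissible_seminorms R = {\<nu>. cstar_seminorm \<nu> \<and> (\<forall>r \<in> R. \<nu> r = 0)}"

definition univ_seminorm :: "'g free_alg set \<Rightarrow> 'g free_alg \<Rightarrow> real" where
  "univ_seminorm R f = (SUP \<nu> \<in> admissible_seminorms R. \<nu> f)"

definition cauchy_ring :: "('g free_alg \<Rightarrow> real) \<Rightarrow> (nat \<Rightarrow> 'g free_alg) ring" where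
  "cauchy_ring \<nu> = \<lparr>
     carrier = {s. \<forall>e>0. \<exists>N. \<forall>m\<ge>N. \<forall>n\<ge>N. \<nu> (s m - s n) < e},
     mult = (\<lambda>s t n. s n * t n), one = (\<lambda>n. 1), zero = (\<lambda>n. 0), add = (\<lambda>s t n. s n + t n)\<rparr>"

definition null_ideal :: "('g free_alg \<Rightarrow> real) \<Rightarrow> (nat \<Rightarrow> 'g free_alg) set" where
  "null_ideal \<nu> = {s. (\<lambda>n. \<nu> (s n)) \<longlonglongrightarrow> 0}"

abbreviation completion_class ::
  "('g free_alg \<Rightarrow> real) \<Rightarrow> (nat \<Rightarrow> 'g free_alg) \<Rightarrow> (nat \<Rightarrow> 'g free_alg) set" where
  "completion_class \<nu> s \<equiv> null_ideal \<nu> +>\<^bsub>cauchy_ring \<nu>\<^esub> s"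

definition cstar_completion ::
  "('g free_alg \<Rightarrow> real) \<Rightarrow> (nat \<Rightarrow> 'g free_alg) set star_algebra" where
  "cstar_completion \<nu> = (let Q = cauchy_ring \<nu> Quot null_ideal \<nu> in \<lparr>
     carrier = carrier Q, mult = mult Q, one = one Q, zero = zero Q, add = add Q,
     scale = (\<lambda>c S. \<Union>s\<in>S. completion_class \<nu> (\<lambda>n. free_scale c (s n))),
     adj = (\<lambda>S. \<Union>s\<in>S. completion_class \<nu> (\<lambda>n. free_adj (s n))),
     nrm = (\<lambda>S. lim (\<lambda>n. \<nu> ((SOME s. s \<in> S) n)))\<rparr>)"

definition free_embed :: "('g free_alg \<Rightarrow> real) \<Rightarrow> 'g free_alg \<Rightarrow> (nat \<Rightarrow> 'g free_alg) set" where
  "free_embed \<nu> f = completion_class \<nu> (\<lambda>n. f)"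


section \<open>Non-signalling games\<close>

text \<open>The finite non-empty sets \<open>X\<close>, \<open>Y\<close>, \<open>A\<close>, \<open>B\<close> are the universes of types of class
  \<^class>\<open>finite\<close>.\<close>

type_synonym ('x, 'y, 'a, 'b) rule = "'x \<Rightarrow> 'y \<Rightarrow> 'a \<Rightarrow> 'b \<Rightarrow> nat"

definition nonsignalling_game :: "('x::finite, 'y::finite, 'a::finite, 'b::finite) rule \<Rightarrow> bool" where
  "nonsignalling_game lam \<longleftrightarrow> (\<forall>x y a b. lam x y a b \<in> {0, 1})"

definition imitation_game :: "('x::finite, 'y::finite, 'a::finite, 'b::finite) rule \<Rightarrow> bool" where
  "imitation_game lam \<longleftrightarrow> nonsignalling_game lam \<and>
     (\<forall>x a a'. a \<noteq> a' \<longrightarrow> (\<exists>y. (\<Sum>b\<in>UNIV. lam x y a b * lam x y a' b) = 0)) \<and>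
     (\<forall>y b b'. b \<noteq> b' \<longrightarrow> (\<exists>x. (\<Sum>a\<in>UNIV. lam x y a b * lam x y a b') = 0))"

datatype ('x, 'y, 'a, 'b) game_gen = GenP 'x 'a | GenQ 'y 'b

text \<open>Generators of the free *-algebra are already self-adjoint, so idempotency is all that is
  needed to make them projections.\<close>

definition game_relations ::
  "('x::finite, 'y::finite, 'a::finite, 'b::finite) rule \<Rightarrow> ('x, 'y, 'a, 'b) game_gen free_alg set" where
  "game_relations lam =
     (let p = (\<lambda>x a. free_gen (GenP x a)); q = (\<lambda>y b. free_gen (GenQ y b)) in
       {p x a * p x a - p x a | x a. True} \<union>
       {q y b * q y b - q y b | y b. True} \<union>
       {(\<Sum>a\<in>UNIV. p x a) - 1 | x. True} \<union>
       {(\<Sum>b\<in>UNIV. q y b) - 1 | y. True} \<union>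
       {p x a * q y b | x y a b. lam x y a b = 0})"

definition game_seminorm ::
  "('x::finite, 'y::finite, 'a::finite, 'b::finite) rule \<Rightarrow> ('x, 'y, 'a, 'b) game_gen free_alg \<Rightarrow> real" where
  "game_seminorm lam = univ_seminorm (game_relations lam)"

text \<open>The theorems \<open>game_cstar_unital_cstar_algebra\<close>, \<open>game_cstar_family\<close>,
  \<open>game_cstar_generated\<close> and \<open>game_cstar_universal\<close> below show that \<open>game_cstar lam\<close> is a unital
  C*-algebra (possibly zero) generated by a family of projections with the required relations, and
  that any such family in any unital C*-algebra arises as its image under a unital
  *-homomorphism.\<close>

definition game_cstar ::
  "('x::finite, 'y::finite, 'a::finite, 'b::finite) rule \<Rightarrow>
     (nat \<Rightarrow> ('x, 'y, 'a, 'b) game_gen free_alg) set star_algebra" where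
  "game_cstar lam = cstar_completion (game_seminorm lam)"

text \<open>A family \<open>p(a,b|x,y)\<close> is a vector indexed by \<open>(a, b, x, y)\<close>.\<close>

definition local_correlations :: "(real ^ ('a::finite \<times> 'b::finite \<times> 'x::finite \<times> 'y::finite)) set" where
  "local_correlations = convex hull
     {vec_lambda (\<lambda>(a, b, x, y). p1 x a * p2 y b) | p1 p2.
        (\<forall>x a. 0 \<le> p1 x a) \<and> (\<forall>x. (\<Sum>a\<in>UNIV. p1 x a) = 1) \<and>
        (\<forall>y b. 0 \<le> p2 y b) \<and> (\<forall>y. (\<Sum>b\<in>UNIV. p2 y b) = 1)}"

definition perfect_local_strategy ::
  "('x::finite, 'y::finite, 'a::finite, 'b::finite) rule \<Rightarrow> real ^ ('a \<times> 'b \<times> 'x \<times> 'y) \<Rightarrow> bool" where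
  "perfect_local_strategy lam p \<longleftrightarrow> p \<in> local_correlations \<and>
     (\<forall>x y a b. lam x y a b = 0 \<longrightarrow> p $ (a, b, x, y) = 0)"


section \<open>Facts about the construction\<close>

subsection \<open>The free *-algebra\<close>

lemma free_scale_eq: "free_scale c f = Poly_Mapping.single 0 c * f"
  by (simp add: free_scale_def mult_map_scale_conv_mult)

lemma free_alg_sum_single:
  fixes f :: "'g free_alg"
  shows "(\<Sum>w\<in>Poly_Mapping.keys f. Poly_Mapping.single w (Poly_Mapping.lookup f w)) = f"
  by (rule poly_mapping_eqI)
     (auto simp: lookup_sum lookup_single when_def sum.delta not_in_keys_iff_lookup_eq_zero)

lemma free_alg_induct [case_names zero single add]:
  fixes f :: "'g free_alg"
  assumes "P 0" "\<And>w c. P (Poly_Mapping.single w c)" "\<And>f g. P f \<Longrightarrow> P g \<Longrightarrow> P (f + g)"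
  shows "P f"
proof -
  have "P (\<Sum>w\<in>S. Poly_Mapping.single w (Poly_Mapping.lookup f w))" if "finite S" for S
    using that by (induction S) (use assms in auto)
  from this[of "Poly_Mapping.keys f"] show ?thesis
    by (simp add: free_alg_sum_single)
qed

lemma free_scale_simps:
  "free_scale 1 f = f"
  "free_scale c (free_scale d f) = free_scale (c * d) f"
  "free_scale (c + d) f = free_scale c f + free_scale d f"
  "free_scale c (f + g) = free_scale c f + free_scale c g"
  "free_scale c (f - g) = free_scale c f - free_scale c g"
  "free_scale c f * g = free_scale c (f * g)"
  "free_scale (-1) f = - f"
  "free_scale 0 f = 0"
  by (simp_all add: free_scale_eq algebra_simps single_add mult_single single_one
      single_uminus flip: mult.assoc)

lemma single_0_commute:
  fixes f :: "'g free_alg"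
  shows "f * Poly_Mapping.single 0 c = Poly_Mapping.single 0 c * f"
  by (induction f rule: free_alg_induct) (simp_all add: mult_single algebra_simps)

lemma free_scale_mult_right: "f * free_scale c g = free_scale c (f * g)"
  by (metis free_scale_eq mult.assoc single_0_commute)

lemma free_scale_single: "free_scale c (Poly_Mapping.single w d) = Poly_Mapping.single w (c * d)"
  by (simp add: free_scale_eq mult_single)

lemma inj_word_rev: "inj word_rev"
  by (rule injI) (metis letters_def rev_rev_ident word.inject word_rev_def word.exhaust_sel)

lemma word_rev_rev [simp]: "word_rev (word_rev w) = w"
  by (simp add: word_rev_def)

lemma word_rev_plus: "word_rev (u + v) = word_rev v + word_rev u"
  by (simp add: word_rev_def plus_word_def)

lemma lookup_free_adj:
  "Poly_Mapping.lookup (free_adj f) w = cnj (Poly_Mapping.lookup f (word_rev w))"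
  by (simp add: free_adj_def map_key.rep_eq[OF inj_word_rev] Poly_Mapping.map.rep_eq when_def)

lemma free_adj_single: "free_adj (Poly_Mapping.single w c) = Poly_Mapping.single (word_rev w) (cnj c)"
proof (rule poly_mapping_eqI)
  fix k
  show "Poly_Mapping.lookup (free_adj (Poly_Mapping.single w c)) k =
    Poly_Mapping.lookup (Poly_Mapping.single (word_rev w) (cnj c)) k"
    by (auto simp: lookup_free_adj lookup_single when_def)
qed

lemma free_adj_add: "free_adj (f + g) = free_adj f + free_adj g"
  by (rule poly_mapping_eqI) (simp add: lookup_free_adj lookup_add)

lemma free_adj_0: "free_adj 0 = 0"
  by (rule poly_mapping_eqI) (simp add: lookup_free_adj)

lemma free_adj_diff: "free_adj (f - g) = free_adj f - free_adj g"
  by (rule poly_mapping_eqI) (simp add: lookup_free_adj lookup_minus)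

lemma free_adj_scale: "free_adj (free_scale c f) = free_scale (cnj c) (free_adj f)"
  by (induction f rule: free_alg_induct)
     (simp_all add: free_scale_single free_adj_single free_adj_add free_scale_simps free_adj_0
       free_scale_eq[of _ 0])

lemma free_adj_adj: "free_adj (free_adj f) = f"
  by (rule poly_mapping_eqI) (simp add: lookup_free_adj)

lemma free_adj_mult: "free_adj (f * g) = free_adj g * free_adj f"
proof (induction f rule: free_alg_induct)
  case (single w c)
  show ?case
    by (induction g rule: free_alg_induct)
       (simp_all add: free_adj_0 free_adj_single mult_single free_adj_add word_rev_plus algebra_simps)
qed (simp_all add: free_adj_0 free_adj_add algebra_simps)

lemma free_adj_1 [simp]: "free_adj 1 = 1"
  by (metis complex_cnj_one free_adj_single single_one word_rev_def letters_def rev.simps(1)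
      word.sel zero_word_def)

lemma free_adj_gen [simp]: "free_adj (free_gen g) = free_gen g"
  by (simp add: free_gen_def free_adj_single word_rev_def)


subsection \<open>C*-seminorms\<close>

locale cstar_seminorm_loc =
  fixes \<nu> :: "'g free_alg \<Rightarrow> real"
  assumes cstar_seminorm: "cstar_seminorm \<nu>"
begin

lemma nonneg: "0 \<le> \<nu> f"
  and triangle: "\<nu> (f + g) \<le> \<nu> f + \<nu> g"
  and scale: "\<nu> (free_scale c f) = cmod c * \<nu> f"
  and submult: "\<nu> (f * g) \<le> \<nu> f * \<nu> g"
  and cstar: "\<nu> (free_adj f * f) = (\<nu> f)\<^sup>2"
  using cstar_seminorm by (auto simp: cstar_seminorm_def)

lemma zero [simp]: "\<nu> 0 = 0"
  using scale[of 0 0] by (simp add: free_scale_simps)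

lemma uminus: "\<nu> (- f) = \<nu> f"
  using scale[of "-1" f] by (simp add: free_scale_simps)

lemma diff_triangle: "\<nu> (f - g) \<le> \<nu> f + \<nu> g"
  using triangle[of f "-g"] by (simp add: uminus)

lemma diff_commute: "\<nu> (f - g) = \<nu> (g - f)"
  using uminus[of "f - g"] by simp

lemma abs_diff_le: "\<bar>\<nu> f - \<nu> g\<bar> \<le> \<nu> (f - g)"
  using triangle[of "f - g" g] triangle[of "g - f" f] diff_commute[of f g] by simp

lemma adj_le: "\<nu> f \<le> \<nu> (free_adj f)"
proof (cases "\<nu> f = 0")
  case False
  have "(\<nu> f)\<^sup>2 \<le> \<nu> (free_adj f) * \<nu> f"
    using cstar[of f] submult[of "free_adj f" f] by simp
  then show ?thesis
    using False nonneg[of f] by (simp add: power2_eq_square)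
qed (simp add: nonneg)

lemma adj: "\<nu> (free_adj f) = \<nu> f"
  using adj_le[of f] adj_le[of "free_adj f"] by (simp add: free_adj_adj)

lemma one_le: "\<nu> 1 \<le> 1"
  using cstar[of 1] by (auto simp: power2_eq_square)

lemma sum_le: "\<nu> (sum f S) \<le> (\<Sum>i\<in>S. \<nu> (f i))"
  by (induction S rule: infinite_finite_induct) (auto intro: order.trans[OF triangle])

lemma projection_le:
  assumes "\<nu> (f * f - f) = 0" "free_adj f = f"
  shows "\<nu> f \<le> 1"
proof -
  have "(\<nu> f)\<^sup>2 = \<nu> f"
    using cstar[of f] assms abs_diff_le[of "f * f" f] by simp
  then show ?thesis by (auto simp: power2_eq_square)
qed

end

lemma cstar_seminorm_zero: "cstar_seminorm (\<lambda>_. 0)"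
  by (simp add: cstar_seminorm_def)

lemma cstar_seminorm_word_le:
  assumes "cstar_seminorm \<nu>" "\<And>g. \<nu> (free_gen g) \<le> 1"
  shows "\<nu> (Poly_Mapping.single (Word ws) 1) \<le> 1"
proof -
  interpret cstar_seminorm_loc \<nu> by standard fact
  show ?thesis
  proof (induction ws)
    case Nil
    then show ?case using one_le by (simp flip: zero_word_def)
  next
    case (Cons g ws)
    have "Poly_Mapping.single (Word (g # ws)) 1 = free_gen g * Poly_Mapping.single (Word ws) (1::complex)"
      by (simp add: free_gen_def mult_single plus_word_def)
    then show ?case
      using submult[of "free_gen g" "Poly_Mapping.single (Word ws) 1"] Cons.IH assms(2)[of g]
      by (metis mult_le_one nonneg order.trans)
  qed
qed

lemma cstar_seminorm_le_coeff_sum: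
  assumes "cstar_seminorm \<nu>" "\<And>g. \<nu> (free_gen g) \<le> 1"
  shows "\<nu> f \<le> (\<Sum>w\<in>Poly_Mapping.keys f. cmod (Poly_Mapping.lookup f w))"
proof -
  interpret cstar_seminorm_loc \<nu> by standard fact
  have *: "\<nu> (Poly_Mapping.single w c) \<le> cmod c" for w c
  proof -
    obtain ws where w: "w = Word ws" by (cases w)
    have "\<nu> (Poly_Mapping.single w c) = cmod c * \<nu> (Poly_Mapping.single w 1)"
      using scale[of c "Poly_Mapping.single w 1"] by (simp add: free_scale_single)
    then show ?thesis
      using cstar_seminorm_word_le[OF assms, of ws] w by (simp add: mult_left_le)
  qed
  have "\<nu> (\<Sum>w\<in>Poly_Mapping.keys f. Poly_Mapping.single w (Poly_Mapping.lookup f w))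
     \<le> (\<Sum>w\<in>Poly_Mapping.keys f. cmod (Poly_Mapping.lookup f w))"
    by (rule order.trans[OF sum_le]) (intro sum_mono *)
  then show ?thesis by (simp add: free_alg_sum_single)
qed

lemma cstar_seminorm_univ:
  assumes bdd: "\<And>f. bdd_above ((\<lambda>\<nu>. \<nu> f) ` admissible_seminorms R)"
  shows "univ_seminorm R \<in> admissible_seminorms R"
proof -
  let ?S = "admissible_seminorms R"
  have ne: "?S \<noteq> {}"
    using cstar_seminorm_zero by (auto simp: admissible_seminorms_def)
  have loc: "cstar_seminorm_loc \<nu>" if "\<nu> \<in> ?S" for \<nu>
    using that by (simp add: admissible_seminorms_def cstar_seminorm_loc_def)
  have ub: "\<nu> f \<le> univ_seminorm R f" if "\<nu> \<in> ?S" for \<nu> f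
    unfolding univ_seminorm_def using that bdd by (rule cSUP_upper)
  have least: "univ_seminorm R f \<le> B" if "\<And>\<nu>. \<nu> \<in> ?S \<Longrightarrow> \<nu> f \<le> B" for f B
    unfolding univ_seminorm_def using ne that by (rule cSUP_least)
  have nn: "0 \<le> univ_seminorm R f" for f
    using ub[of "\<lambda>_. 0" f] cstar_seminorm_zero by (simp add: admissible_seminorms_def)
  have sc: "univ_seminorm R (free_scale c f) \<le> cmod c * univ_seminorm R f" for c f
    by (rule least) (simp add: cstar_seminorm_loc.scale[OF loc] mult_left_mono ub)
  have "cstar_seminorm (univ_seminorm R)"
    unfolding cstar_seminorm_def
  proof (intro conjI allI)
    fix f g c
    show "univ_seminorm R (f + g) \<le> univ_seminorm R f + univ_seminorm R g"
      by (rule least) (meson add_mono cstar_seminorm_loc.triangle loc order_trans ub)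
    show "univ_seminorm R (f * g) \<le> univ_seminorm R f * univ_seminorm R g"
      by (rule least) (meson mult_mono cstar_seminorm_loc.submult cstar_seminorm_loc.nonneg
          loc order_trans ub nn)
    show "univ_seminorm R (free_scale c f) = cmod c * univ_seminorm R f"
    proof (cases "c = 0")
      case True
      then show ?thesis using sc[of 0 f] nn[of "free_scale 0 f"] by simp
    next
      case False
      have "univ_seminorm R f \<le> cmod (1 / c) * univ_seminorm R (free_scale c f)"
        using sc[of "1 / c" "free_scale c f"] False by (simp add: free_scale_simps)
      then show ?thesis
        using sc[of c f] False by (simp add: norm_divide field_simps)
    qed
    show "univ_seminorm R (free_adj f * f) = (univ_seminorm R f)\<^sup>2"
    proof (rule antisym)
      show "univ_seminorm R (free_adj f * f) \<le> (univ_seminorm R f)\<^sup>2"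
        by (rule least) (simp add: cstar_seminorm_loc.cstar[OF loc]
            cstar_seminorm_loc.nonneg[OF loc] power_mono ub)
      have "univ_seminorm R f \<le> sqrt (univ_seminorm R (free_adj f * f))"
        by (rule least) (metis cstar_seminorm_loc.cstar loc real_le_rsqrt ub)
      then show "(univ_seminorm R f)\<^sup>2 \<le> univ_seminorm R (free_adj f * f)"
        using nn by (metis nn power_mono real_sqrt_pow2)
    qed
  qed (rule nn)
  moreover have "univ_seminorm R r = 0" if "r \<in> R" for r
    using least[of r 0] nn[of r] that by (simp add: admissible_seminorms_def)
  ultimately show ?thesis by (simp add: admissible_seminorms_def)
qed

lemma game_seminorms_bdd:
  "bdd_above ((\<lambda>\<nu>. \<nu> f) ` admissible_seminorms (game_relations lam))"
proof (rule bdd_aboveI2)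
  fix \<nu> assume \<nu>: "\<nu> \<in> admissible_seminorms (game_relations lam)"
  then interpret cstar_seminorm_loc \<nu>
    by unfold_locales (simp add: admissible_seminorms_def)
  have "free_gen g * free_gen g - free_gen g \<in> game_relations lam" for g
    by (cases g) (auto simp: game_relations_def Let_def)
  then have "\<nu> (free_gen g * free_gen g - free_gen g) = 0" for g
    using \<nu> by (simp add: admissible_seminorms_def)
  then show "\<nu> f \<le> (\<Sum>w\<in>Poly_Mapping.keys f. cmod (Poly_Mapping.lookup f w))"
    by (intro cstar_seminorm_le_coeff_sum cstar_seminorm projection_le free_adj_gen)
qed

lemma game_seminorm_admissible: "game_seminorm lam \<in> admissible_seminorms (game_relations lam)"
  unfolding game_seminorm_def by (intro cstar_seminorm_univ game_seminorms_bdd)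

lemma game_seminorm_ge: "\<nu> \<in> admissible_seminorms (game_relations lam) \<Longrightarrow> \<nu> f \<le> game_seminorm lam f"
  unfolding game_seminorm_def univ_seminorm_def using game_seminorms_bdd by (intro cSUP_upper)


subsection \<open>The completion with respect to a C*-seminorm\<close>

context cstar_seminorm_loc
begin

definition is_cauchy :: "(nat \<Rightarrow> 'g free_alg) \<Rightarrow> bool" where
  "is_cauchy s \<longleftrightarrow> s \<in> carrier (cauchy_ring \<nu>)"

lemma is_cauchy_iff: "is_cauchy s \<longleftrightarrow> (\<forall>e>0. \<exists>N. \<forall>m\<ge>N. \<forall>n\<ge>N. \<nu> (s m - s n) < e)"
  by (simp add: is_cauchy_def cauchy_ring_def)

lemma cauchy_ring_simps:
  "carrier (cauchy_ring \<nu>) = {s. is_cauchy s}"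
  "s \<otimes>\<^bsub>cauchy_ring \<nu>\<^esub> t = (\<lambda>n. s n * t n)"
  "s \<oplus>\<^bsub>cauchy_ring \<nu>\<^esub> t = (\<lambda>n. s n + t n)"
  "\<one>\<^bsub>cauchy_ring \<nu>\<^esub> = (\<lambda>n. 1)"
  "\<zero>\<^bsub>cauchy_ring \<nu>\<^esub> = (\<lambda>n. 0)"
  by (simp_all add: is_cauchy_def) (simp_all add: cauchy_ring_def)

lemma null_cong:
  assumes "(\<lambda>n. B n) \<longlonglongrightarrow> 0" "\<And>n. \<nu> (s n) \<le> B n"
  shows "(\<lambda>n. \<nu> (s n)) \<longlonglongrightarrow> 0"
  by (rule tendsto_sandwich[OF _ _ tendsto_const assms(1)]) (auto simp: nonneg assms)

lemma is_cauchy_const [simp]: "is_cauchy (\<lambda>n. f)"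
  by (simp add: is_cauchy_iff)

lemma is_cauchy_bounded:
  assumes "is_cauchy s" obtains B where "B > 0" "\<And>n. \<nu> (s n) \<le> B"
proof -
  from assms obtain N where N: "\<And>m n. m \<ge> N \<Longrightarrow> n \<ge> N \<Longrightarrow> \<nu> (s m - s n) < 1"
    unfolding is_cauchy_iff using zero_less_one by blast
  define B where "B = 1 + \<nu> (s N) + (\<Sum>k\<le>N. \<nu> (s k))"
  have S: "0 \<le> (\<Sum>k\<le>N. \<nu> (s k))" by (intro sum_nonneg nonneg)
  have "\<nu> (s n) \<le> B" for n
  proof (cases "n \<ge> N")
    case True
    then show ?thesis
      using N[of n N] triangle[of "s n - s N" "s N"] S by (simp add: B_def)
  next
    case False
    then have "\<nu> (s n) \<le> (\<Sum>k\<le>N. \<nu> (s k))"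
      by (intro member_le_sum) (auto simp: nonneg)
    then show ?thesis using nonneg[of "s N"] by (simp add: B_def)
  qed
  moreover have "B > 0" using S nonneg[of "s N"] by (simp add: B_def)
  ultimately show ?thesis using that by blast
qed

lemma is_cauchy_lipschitz:
  assumes "is_cauchy s" "B > 0" "\<And>m n. \<nu> (t m - t n) \<le> B * \<nu> (s m - s n)"
  shows "is_cauchy t"
  unfolding is_cauchy_iff
proof (intro allI impI)
  fix e :: real assume "e > 0"
  then obtain N where "\<forall>m\<ge>N. \<forall>n\<ge>N. \<nu> (s m - s n) < e / B"
    using assms(1,2) unfolding is_cauchy_iff by (meson divide_pos_pos)
  then have "\<forall>m\<ge>N. \<forall>n\<ge>N. \<nu> (t m - t n) < e"
    using assms(2,3) by (metis le_less_trans mult.commute pos_less_divide_eq)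
  then show "\<exists>N. \<forall>m\<ge>N. \<forall>n\<ge>N. \<nu> (t m - t n) < e" by blast
qed

lemma is_cauchy_add:
  assumes "is_cauchy s" "is_cauchy t"
  shows "is_cauchy (\<lambda>n. s n + t n)"
  unfolding is_cauchy_iff
proof (intro allI impI)
  fix e :: real assume "e > 0"
  then have e: "e / 2 > 0" by simp
  obtain N1 where N1: "\<forall>m\<ge>N1. \<forall>n\<ge>N1. \<nu> (s m - s n) < e / 2"
    using assms(1) e unfolding is_cauchy_iff by blast
  obtain N2 where N2: "\<forall>m\<ge>N2. \<forall>n\<ge>N2. \<nu> (t m - t n) < e / 2"
    using assms(2) e unfolding is_cauchy_iff by blast
  have "\<nu> (s m + t m - (s n + t n)) < e" if "m \<ge> max N1 N2" "n \<ge> max N1 N2" for m n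
  proof -
    have "\<nu> (s m + t m - (s n + t n)) \<le> \<nu> (s m - s n) + \<nu> (t m - t n)"
      using triangle[of "s m - s n" "t m - t n"] by (simp add: algebra_simps)
    moreover have "\<nu> (s m - s n) < e / 2" "\<nu> (t m - t n) < e / 2"
      using that N1 N2 by auto
    ultimately show ?thesis by linarith
  qed
  then show "\<exists>N. \<forall>m\<ge>N. \<forall>n\<ge>N. \<nu> (s m + t m - (s n + t n)) < e" by blast
qed

lemma is_cauchy_scale:
  assumes "is_cauchy s" shows "is_cauchy (\<lambda>n. free_scale c (s n))"
proof (rule is_cauchy_lipschitz[OF assms, of "cmod c + 1"])
  fix m n
  show "\<nu> (free_scale c (s m) - free_scale c (s n)) \<le> (cmod c + 1) * \<nu> (s m - s n)"
    using nonneg[of "s m - s n"] by (simp add: scale algebra_simps flip: free_scale_simps(5))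
qed (simp add: add_nonneg_pos)

lemma is_cauchy_adj:
  assumes "is_cauchy s" shows "is_cauchy (\<lambda>n. free_adj (s n))"
  by (rule is_cauchy_lipschitz[OF assms, of 1]) (simp_all add: adj flip: free_adj_diff)

lemma is_cauchy_uminus:
  assumes "is_cauchy s" shows "is_cauchy (\<lambda>n. - s n)"
  using is_cauchy_scale[OF assms, of "-1"] by (simp add: free_scale_simps)

lemma is_cauchy_diff:
  assumes "is_cauchy s" "is_cauchy t" shows "is_cauchy (\<lambda>n. s n - t n)"
  using is_cauchy_add[OF assms(1) is_cauchy_uminus[OF assms(2)]] by simp

lemma mult_diff_le: "\<nu> (a * b - c * d) \<le> \<nu> (a - c) * \<nu> b + \<nu> c * \<nu> (b - d)"
proof -
  have "a * b - c * d = (a - c) * b + c * (b - d)" by (simp add: algebra_simps)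
  then show ?thesis
    using triangle[of "(a - c) * b" "c * (b - d)"] submult[of "a - c" b] submult[of c "b - d"]
    by simp
qed

lemma is_cauchy_mult:
  assumes "is_cauchy s" "is_cauchy t"
  shows "is_cauchy (\<lambda>n. s n * t n)"
  unfolding is_cauchy_iff
proof (intro allI impI)
  fix e :: real assume "e > 0"
  obtain B where B: "B > 0" "\<And>n. \<nu> (s n) \<le> B" by (rule is_cauchy_bounded[OF assms(1)]) blast
  obtain D where D: "D > 0" "\<And>n. \<nu> (t n) \<le> D" by (rule is_cauchy_bounded[OF assms(2)]) blast
  have e1: "e / (2 * D) > 0" and e2: "e / (2 * B) > 0" using \<open>e > 0\<close> B D by simp_all
  obtain N1 where N1: "\<forall>m\<ge>N1. \<forall>n\<ge>N1. \<nu> (s m - s n) < e / (2 * D)"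
    using assms(1) e1 unfolding is_cauchy_iff by blast
  obtain N2 where N2: "\<forall>m\<ge>N2. \<forall>n\<ge>N2. \<nu> (t m - t n) < e / (2 * B)"
    using assms(2) e2 unfolding is_cauchy_iff by blast
  have "\<nu> (s m * t m - s n * t n) < e" if "m \<ge> max N1 N2" "n \<ge> max N1 N2" for m n
  proof -
    have s: "\<nu> (s m - s n) < e / (2 * D)" and t: "\<nu> (t m - t n) < e / (2 * B)"
      using that N1 N2 by auto
    have "\<nu> (s m - s n) * \<nu> (t m) \<le> \<nu> (s m - s n) * D"
      using D by (intro mult_left_mono) (auto simp: nonneg)
    also have "\<dots> < e / 2" using s D by (simp add: field_simps)
    finally have 1: "\<nu> (s m - s n) * \<nu> (t m) < e / 2" .
    have "\<nu> (s n) * \<nu> (t m - t n) \<le> B * \<nu> (t m - t n)"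
      using B by (intro mult_right_mono) (auto simp: nonneg)
    also have "\<dots> < e / 2" using t B by (simp add: field_simps)
    finally show ?thesis using 1 mult_diff_le[of "s m" "t m" "s n" "t n"] by linarith
  qed
  then show "\<exists>N. \<forall>m\<ge>N. \<forall>n\<ge>N. \<nu> (s m * t m - s n * t n) < e" by blast
qed

lemmas is_cauchy_intros = is_cauchy_const is_cauchy_add is_cauchy_scale is_cauchy_adj
  is_cauchy_uminus is_cauchy_diff is_cauchy_mult

lemma is_cauchy_convergent:
  assumes "is_cauchy s" shows "convergent (\<lambda>n. \<nu> (s n))"
proof -
  have "Cauchy (\<lambda>n. \<nu> (s n))"
    unfolding Cauchy_def dist_real_def
    using assms unfolding is_cauchy_iff by (meson abs_diff_le le_less_trans)
  then show ?thesis by (simp add: Cauchy_convergent)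
qed

lemma null_is_cauchy:
  assumes "(\<lambda>n. \<nu> (s n)) \<longlonglongrightarrow> 0" shows "is_cauchy s"
  unfolding is_cauchy_iff
proof (intro allI impI)
  fix e :: real assume "e > 0"
  then have "\<forall>\<^sub>F n in sequentially. \<nu> (s n) < e / 2"
    using assms by (intro order_tendstoD) auto
  then obtain N where N: "\<And>n. n \<ge> N \<Longrightarrow> \<nu> (s n) < e / 2"
    unfolding eventually_sequentially by blast
  have "\<nu> (s m - s n) < e" if "m \<ge> N" "n \<ge> N" for m n
    using diff_triangle[of "s m" "s n"] N[OF that(1)] N[OF that(2)] by linarith
  then show "\<exists>N. \<forall>m\<ge>N. \<forall>n\<ge>N. \<nu> (s m - s n) < e" by blast
qed

lemma ring_cauchy: "ring (cauchy_ring \<nu>)"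
proof (rule ringI)
  show "abelian_group (cauchy_ring \<nu>)"
  proof (rule abelian_groupI)
    fix x assume "x \<in> carrier (cauchy_ring \<nu>)"
    then show "\<exists>y\<in>carrier (cauchy_ring \<nu>). y \<oplus>\<^bsub>cauchy_ring \<nu>\<^esub> x = \<zero>\<^bsub>cauchy_ring \<nu>\<^esub>"
      by (intro bexI[of _ "\<lambda>n. - x n"]) (auto simp: cauchy_ring_simps is_cauchy_uminus)
  qed (auto simp: cauchy_ring_simps is_cauchy_intros add_ac)
  show "Group.monoid (cauchy_ring \<nu>)"
    by (rule monoidI) (auto simp: cauchy_ring_simps is_cauchy_intros mult.assoc)
qed (auto simp: cauchy_ring_simps algebra_simps)

lemma cauchy_uminus:
  assumes "is_cauchy s" shows "\<ominus>\<^bsub>cauchy_ring \<nu>\<^esub> s = (\<lambda>n. - s n)"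
proof -
  interpret R: ring "cauchy_ring \<nu>" by (rule ring_cauchy)
  show ?thesis
    by (rule R.minus_equality) (auto simp: cauchy_ring_simps is_cauchy_uminus assms)
qed

lemma ideal_null: "ideal (null_ideal \<nu>) (cauchy_ring \<nu>)"
proof (rule idealI[OF ring_cauchy])
  interpret R: ring "cauchy_ring \<nu>" by (rule ring_cauchy)
  show "subgroup (null_ideal \<nu>) (add_monoid (cauchy_ring \<nu>))"
  proof (rule R.add.subgroupI)
    show "null_ideal \<nu> \<subseteq> carrier (cauchy_ring \<nu>)"
      by (auto simp: null_ideal_def cauchy_ring_simps null_is_cauchy)
    have "(\<lambda>n. 0) \<in> null_ideal \<nu>" by (simp add: null_ideal_def)
    then show "null_ideal \<nu> \<noteq> {}" by blast
  next
    fix a assume "a \<in> null_ideal \<nu>"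
    then show "\<ominus>\<^bsub>cauchy_ring \<nu>\<^esub> a \<in> null_ideal \<nu>"
      by (simp add: null_ideal_def null_is_cauchy cauchy_uminus uminus)
  next
    fix a b assume "a \<in> null_ideal \<nu>" "b \<in> null_ideal \<nu>"
    then show "a \<oplus>\<^bsub>cauchy_ring \<nu>\<^esub> b \<in> null_ideal \<nu>"
      unfolding null_ideal_def mem_Collect_eq cauchy_ring_simps
      by (intro null_cong[OF tendsto_add_zero triangle])
  qed
next
  fix a x assume a: "a \<in> null_ideal \<nu>" and x: "x \<in> carrier (cauchy_ring \<nu>)"
  then have "is_cauchy x" by (simp add: cauchy_ring_simps)
  then obtain B where B: "\<And>n. \<nu> (x n) \<le> B" by (rule is_cauchy_bounded) blast
  have lim: "(\<lambda>n. B * \<nu> (a n)) \<longlonglongrightarrow> 0"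
    using a by (auto simp: null_ideal_def intro: tendsto_mult_right_zero)
  have "\<nu> (x n * a n) \<le> B * \<nu> (a n)" "\<nu> (a n * x n) \<le> B * \<nu> (a n)" for n
    using submult[of "x n" "a n"] submult[of "a n" "x n"] mult_right_mono[OF B nonneg, of n "a n"]
    by (simp_all add: mult.commute[of "\<nu> (a n)"])
  with lim show "x \<otimes>\<^bsub>cauchy_ring \<nu>\<^esub> a \<in> null_ideal \<nu>" "a \<otimes>\<^bsub>cauchy_ring \<nu>\<^esub> x \<in> null_ideal \<nu>"
    unfolding null_ideal_def mem_Collect_eq cauchy_ring_simps by (auto intro: null_cong)
qed

sublocale N: ideal "null_ideal \<nu>" "cauchy_ring \<nu>"
  by (rule ideal_null)

abbreviation cls :: "(nat \<Rightarrow> 'g free_alg) \<Rightarrow> (nat \<Rightarrow> 'g free_alg) set" where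
  "cls \<equiv> completion_class \<nu>"

abbreviation K :: "(nat \<Rightarrow> 'g free_alg) set star_algebra" where
  "K \<equiv> cstar_completion \<nu>"

lemma mem_cls: "t \<in> cls s \<longleftrightarrow> (\<lambda>n. \<nu> (t n - s n)) \<longlonglongrightarrow> 0"
proof
  assume "(\<lambda>n. \<nu> (t n - s n)) \<longlonglongrightarrow> 0"
  then show "t \<in> cls s"
    by (auto simp: a_r_coset_def' null_ideal_def cauchy_ring_simps intro!: exI[of _ "\<lambda>n. t n - s n"])
qed (auto simp: a_r_coset_def' null_ideal_def cauchy_ring_simps)

lemma self_mem_cls: "s \<in> cls s"
  by (simp add: mem_cls)

lemma cls_eq_iff: "cls s = cls t \<longleftrightarrow> (\<lambda>n. \<nu> (s n - t n)) \<longlonglongrightarrow> 0"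
proof
  assume "cls s = cls t"
  then show "(\<lambda>n. \<nu> (s n - t n)) \<longlonglongrightarrow> 0" using self_mem_cls[of s] by (simp add: mem_cls)
next
  assume *: "(\<lambda>n. \<nu> (s n - t n)) \<longlonglongrightarrow> 0"
  have "(\<lambda>n. \<nu> (u n - s n)) \<longlonglongrightarrow> 0 \<longleftrightarrow> (\<lambda>n. \<nu> (u n - t n)) \<longlonglongrightarrow> 0" for u
  proof
    assume "(\<lambda>n. \<nu> (u n - s n)) \<longlonglongrightarrow> 0"
    from tendsto_add_zero[OF this *] show "(\<lambda>n. \<nu> (u n - t n)) \<longlonglongrightarrow> 0"
    proof (rule null_cong)
      show "\<nu> (u n - t n) \<le> \<nu> (u n - s n) + \<nu> (s n - t n)" for n
        using triangle[of "u n - s n" "s n - t n"] by simp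
    qed
  next
    assume "(\<lambda>n. \<nu> (u n - t n)) \<longlonglongrightarrow> 0"
    from tendsto_add_zero[OF this *] show "(\<lambda>n. \<nu> (u n - s n)) \<longlonglongrightarrow> 0"
    proof (rule null_cong)
      show "\<nu> (u n - s n) \<le> \<nu> (u n - t n) + \<nu> (s n - t n)" for n
        using triangle[of "u n - t n" "t n - s n"] by (simp add: diff_commute[of "s n"])
    qed
  qed
  then show "cls s = cls t" by (auto simp: mem_cls)
qed

lemma carrier_K: "carrier K = cls ` {s. is_cauchy s}"
  by (auto simp: cstar_completion_def Let_def FactRing_def A_RCOSETS_def' cauchy_ring_simps)

lemma cls_carrier [simp, intro]: "is_cauchy s \<Longrightarrow> cls s \<in> carrier K"
  by (simp add: carrier_K)

lemma K_cases:
  assumes "x \<in> carrier K" obtains s where "is_cauchy s" "x = cls s"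
  using assms by (auto simp: carrier_K)

lemma add_K: "is_cauchy s \<Longrightarrow> is_cauchy t \<Longrightarrow> cls s \<oplus>\<^bsub>K\<^esub> cls t = cls (\<lambda>n. s n + t n)"
  using N.a_rcos_sum[of s t]
  by (simp add: cstar_completion_def Let_def FactRing_def cauchy_ring_simps)

lemma mult_K: "is_cauchy s \<Longrightarrow> is_cauchy t \<Longrightarrow> cls s \<otimes>\<^bsub>K\<^esub> cls t = cls (\<lambda>n. s n * t n)"
  using N.rcoset_mult_add[of s t]
  by (simp add: cstar_completion_def Let_def FactRing_def cauchy_ring_simps)

lemma one_K: "\<one>\<^bsub>K\<^esub> = cls (\<lambda>n. 1)"
  by (simp add: cstar_completion_def Let_def FactRing_def cauchy_ring_simps)

lemma zero_K: "\<zero>\<^bsub>K\<^esub> = cls (\<lambda>n. 0)"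
proof -
  have "\<zero>\<^bsub>K\<^esub> = null_ideal \<nu>" by (simp add: cstar_completion_def Let_def FactRing_def)
  also have "\<dots> = cls (\<lambda>n. 0)" by (auto simp: mem_cls) (auto simp: null_ideal_def)
  finally show ?thesis .
qed

lemma scale_K: "scale K c (cls s) = cls (\<lambda>n. free_scale c (s n))"
proof -
  have "cls (\<lambda>n. free_scale c (t n)) = cls (\<lambda>n. free_scale c (s n))" if "t \<in> cls s" for t
    using that by (auto simp: cls_eq_iff mem_cls scale intro: tendsto_mult_right_zero
        simp flip: free_scale_simps(5))
  then have "(\<Union>t\<in>cls s. cls (\<lambda>n. free_scale c (t n))) = (\<Union>t\<in>cls s. cls (\<lambda>n. free_scale c (s n)))"
    by blast
  also have "\<dots> = cls (\<lambda>n. free_scale c (s n))" using self_mem_cls by blast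
  finally show ?thesis by (simp add: cstar_completion_def Let_def)
qed

lemma adj_K: "adj K (cls s) = cls (\<lambda>n. free_adj (s n))"
proof -
  have "cls (\<lambda>n. free_adj (t n)) = cls (\<lambda>n. free_adj (s n))" if "t \<in> cls s" for t
    using that by (simp add: cls_eq_iff mem_cls adj flip: free_adj_diff)
  then have "(\<Union>t\<in>cls s. cls (\<lambda>n. free_adj (t n))) = (\<Union>t\<in>cls s. cls (\<lambda>n. free_adj (s n)))"
    by blast
  also have "\<dots> = cls (\<lambda>n. free_adj (s n))" using self_mem_cls by blast
  finally show ?thesis by (simp add: cstar_completion_def Let_def)
qed

lemma nrm_K:
  assumes "is_cauchy s" shows "(\<lambda>n. \<nu> (s n)) \<longlonglongrightarrow> nrm K (cls s)"
proof -
  define t where "t = (SOME t. t \<in> cls s)"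
  have "t \<in> cls s" unfolding t_def
    by (rule someI[of "\<lambda>t. t \<in> cls s" s]) (rule self_mem_cls)
  then have "(\<lambda>n. \<nu> (t n - s n)) \<longlonglongrightarrow> 0" by (simp only: mem_cls)
  then have "(\<lambda>n. \<nu> (t n) - \<nu> (s n)) \<longlonglongrightarrow> 0"
    by (rule Lim_null_comparison[rotated]) (simp add: abs_diff_le)
  moreover obtain L where L: "(\<lambda>n. \<nu> (s n)) \<longlonglongrightarrow> L"
    using is_cauchy_convergent[OF assms] convergentD by blast
  ultimately have "(\<lambda>n. (\<nu> (t n) - \<nu> (s n)) + \<nu> (s n)) \<longlonglongrightarrow> 0 + L"
    by (intro tendsto_add)
  then have "lim (\<lambda>n. \<nu> (t n)) = L" by (simp add: limI)
  then show ?thesis using L by (simp add: cstar_completion_def Let_def t_def)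
qed

lemma nrm_K_eq: "is_cauchy s \<Longrightarrow> (\<lambda>n. \<nu> (s n)) \<longlonglongrightarrow> L \<Longrightarrow> nrm K (cls s) = L"
  by (rule LIMSEQ_unique[OF nrm_K])

lemma nrm_K_le:
  assumes "is_cauchy s" "\<And>n. n \<ge> N \<Longrightarrow> \<nu> (s n) \<le> B"
  shows "nrm K (cls s) \<le> B"
  by (rule LIMSEQ_le_const2[OF nrm_K[OF assms(1)]]) (use assms(2) in auto)

lemma ring_K: "ring K"
proof (rule ringI)
  show "abelian_group K"
  proof (rule abelian_groupI)
    fix x assume "x \<in> carrier K"
    then show "\<exists>y\<in>carrier K. y \<oplus>\<^bsub>K\<^esub> x = \<zero>\<^bsub>K\<^esub>"
    proof (elim K_cases)
      fix s assume "is_cauchy s" "x = cls s"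
      then show ?thesis
        by (intro bexI[of _ "cls (\<lambda>n. - s n)"]) (auto simp: add_K zero_K is_cauchy_intros)
    qed
  qed (auto elim!: K_cases simp: add_K zero_K is_cauchy_intros add_ac)
  show "Group.monoid K"
    by (rule monoidI) (auto elim!: K_cases simp: mult_K one_K is_cauchy_intros mult.assoc)
qed (auto elim!: K_cases simp: mult_K add_K is_cauchy_intros algebra_simps)

lemma minus_K:
  assumes "is_cauchy s" "is_cauchy t"
  shows "cls s \<ominus>\<^bsub>K\<^esub> cls t = cls (\<lambda>n. s n - t n)"
proof -
  interpret ring K by (rule ring_K)
  have "\<ominus>\<^bsub>K\<^esub> cls t = cls (\<lambda>n. - t n)"
    by (rule minus_equality) (auto simp: add_K zero_K assms is_cauchy_intros)
  then show ?thesis using assms by (simp add: minus_eq add_K is_cauchy_intros)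
qed

lemma nrm_K_nonneg: "x \<in> carrier K \<Longrightarrow> 0 \<le> nrm K x"
  by (elim K_cases) (auto intro: LIMSEQ_le_const[OF nrm_K] simp: nonneg)

lemma nrm_K_add:
  assumes "x \<in> carrier K" "y \<in> carrier K" shows "nrm K (x \<oplus>\<^bsub>K\<^esub> y) \<le> nrm K x + nrm K y"
  using assms
proof (elim K_cases)
  fix s t assume st: "is_cauchy s" "is_cauchy t" and xy: "x = cls s" "y = cls t"
  have "nrm K (cls (\<lambda>n. s n + t n)) \<le> nrm K (cls s) + nrm K (cls t)"
    by (rule LIMSEQ_le[OF nrm_K tendsto_add[OF nrm_K nrm_K]]) (auto simp: st is_cauchy_intros triangle)
  then show ?thesis by (simp add: xy st add_K)
qed

lemma nrm_K_mult:
  assumes "x \<in> carrier K" "y \<in> carrier K" shows "nrm K (x \<otimes>\<^bsub>K\<^esub> y) \<le> nrm K x * nrm K y"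
  using assms
proof (elim K_cases)
  fix s t assume st: "is_cauchy s" "is_cauchy t" and xy: "x = cls s" "y = cls t"
  have "nrm K (cls (\<lambda>n. s n * t n)) \<le> nrm K (cls s) * nrm K (cls t)"
    by (rule LIMSEQ_le[OF nrm_K tendsto_mult[OF nrm_K nrm_K]]) (auto simp: st is_cauchy_intros submult)
  then show ?thesis by (simp add: xy st mult_K)
qed

lemma nrm_K_eq_0: "x \<in> carrier K \<Longrightarrow> nrm K x = 0 \<longleftrightarrow> x = \<zero>\<^bsub>K\<^esub>"
proof (elim K_cases)
  fix s assume s: "is_cauchy s" "x = cls s"
  show ?thesis
    using nrm_K[OF s(1)] nrm_K_eq[OF s(1), of 0] s by (auto simp: zero_K cls_eq_iff)
qed

lemma adj_nrm_K: "x \<in> carrier K \<Longrightarrow> nrm K (adj K x \<otimes>\<^bsub>K\<^esub> x) = (nrm K x)\<^sup>2"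
  by (elim K_cases)
     (auto simp: adj_K mult_K is_cauchy_intros cstar intro!: nrm_K_eq tendsto_power nrm_K)

lemma nrm_K_scale: "x \<in> carrier K \<Longrightarrow> nrm K (scale K c x) = cmod c * nrm K x"
  by (elim K_cases)
     (auto simp: scale_K is_cauchy_intros scale intro!: nrm_K_eq tendsto_mult_left nrm_K)

lemma complete_K:
  assumes carr: "\<And>n. \<sigma> n \<in> carrier K"
    and cauchy: "\<And>e. 0 < e \<Longrightarrow> \<exists>N. \<forall>m\<ge>N. \<forall>n\<ge>N. nrm K (\<sigma> m \<ominus>\<^bsub>K\<^esub> \<sigma> n) < e"
  shows "\<exists>x \<in> carrier K. (\<lambda>n. nrm K (\<sigma> n \<ominus>\<^bsub>K\<^esub> x)) \<longlonglongrightarrow> 0"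
proof -
  interpret ring K by (rule ring_K)
  have "\<forall>k. \<exists>s. is_cauchy s \<and> \<sigma> k = cls s"
    using carr K_cases by metis
  then obtain s where s: "\<And>k. is_cauchy (s k)" "\<And>k. \<sigma> k = cls (s k)"
    by metis
  have "\<exists>N. \<forall>n\<ge>N. \<forall>m\<ge>N. \<nu> (s k n - s k m) < 1 / Suc k" for k
    using s(1)[of k] unfolding is_cauchy_iff by simp
  then obtain N where N: "\<And>k n m. n \<ge> N k \<Longrightarrow> m \<ge> N k \<Longrightarrow> \<nu> (s k n - s k m) < 1 / Suc k"
    by metis
  define f where "f k = s k (N k)" for k
  have approx: "nrm K (cls (\<lambda>n. s k n - f k)) \<le> 1 / Suc k" for k
    by (rule nrm_K_le[where N = "N k"])
       (simp_all add: f_def s is_cauchy_intros less_imp_le[OF N] del: of_nat_Suc)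
  have diff: "\<nu> (f k - f l) \<le> 1 / Suc k + 1 / Suc l + nrm K (\<sigma> k \<ominus>\<^bsub>K\<^esub> \<sigma> l)" for k l
  proof (rule LIMSEQ_le_const)
    have "(\<lambda>n. \<nu> (s k n - s l n)) \<longlonglongrightarrow> nrm K (\<sigma> k \<ominus>\<^bsub>K\<^esub> \<sigma> l)"
      by (simp add: s minus_K nrm_K is_cauchy_intros)
    then show "(\<lambda>n. 1 / Suc k + 1 / Suc l + \<nu> (s k n - s l n))
        \<longlonglongrightarrow> 1 / Suc k + 1 / Suc l + nrm K (\<sigma> k \<ominus>\<^bsub>K\<^esub> \<sigma> l)"
      by (intro tendsto_add tendsto_const)
    have "\<nu> (f k - f l) \<le> 1 / Suc k + 1 / Suc l + \<nu> (s k n - s l n)" if "n \<ge> max (N k) (N l)" for n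
    proof -
      have "\<nu> (f k - s k n) < 1 / Suc k" "\<nu> (s l n - f l) < 1 / Suc l"
        using that unfolding f_def by (intro N; simp)+
      moreover have "\<nu> (f k - f l) \<le> \<nu> (f k - s k n) + (\<nu> (s k n - s l n) + \<nu> (s l n - f l))"
        using triangle[of "f k - s k n" "s k n - f l"] triangle[of "s k n - s l n" "s l n - f l"]
        by simp
      ultimately show ?thesis by linarith
    qed
    then show "\<exists>n0. \<forall>n\<ge>n0. \<nu> (f k - f l) \<le> 1 / Suc k + 1 / Suc l + \<nu> (s k n - s l n)"
      by blast
  qed
  have small: "\<exists>M. \<forall>k\<ge>M. 1 / Suc k < e" if "e > 0" for e :: real
  proof -
    have "\<forall>\<^sub>F k in sequentially. 1 / Suc k < e"
      using lim_inverse_n'[THEN LIMSEQ_Suc] that by (intro order_tendstoD) auto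
    then show ?thesis by (simp add: eventually_sequentially)
  qed
  have f: "is_cauchy f"
    unfolding is_cauchy_iff
  proof (intro allI impI)
    fix e :: real assume "e > 0"
    then have e: "e / 3 > 0" by simp
    obtain M1 where M1: "\<forall>k\<ge>M1. 1 / Suc k < e / 3" using small[OF e] by blast
    obtain M2 where M2: "\<forall>k\<ge>M2. \<forall>l\<ge>M2. nrm K (\<sigma> k \<ominus>\<^bsub>K\<^esub> \<sigma> l) < e / 3" using cauchy[OF e] by blast
    have "\<nu> (f k - f l) < e" if "k \<ge> max M1 M2" "l \<ge> max M1 M2" for k l
    proof -
      have "1 / Suc k < e / 3" "1 / Suc l < e / 3" "nrm K (\<sigma> k \<ominus>\<^bsub>K\<^esub> \<sigma> l) < e / 3"
        using that M1 M2 by auto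
      then show ?thesis using diff[of k l] by linarith
    qed
    then show "\<exists>M. \<forall>k\<ge>M. \<forall>l\<ge>M. \<nu> (f k - f l) < e" by blast
  qed
  have "(\<lambda>k. nrm K (\<sigma> k \<ominus>\<^bsub>K\<^esub> cls f)) \<longlonglongrightarrow> 0"
  proof (rule LIMSEQ_I)
    fix e :: real assume "e > 0"
    then have e: "e / 3 > 0" by simp
    obtain M1 where M1: "\<forall>k\<ge>M1. 1 / Suc k < e / 3" using small[OF e] by blast
    obtain M2 where M2: "\<forall>k\<ge>M2. \<forall>l\<ge>M2. \<nu> (f k - f l) < e / 3"
      using f e unfolding is_cauchy_iff by blast
    have "norm (nrm K (\<sigma> k \<ominus>\<^bsub>K\<^esub> cls f) - 0) < e" if "k \<ge> max M1 M2" for k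
    proof -
      have "\<sigma> k \<ominus>\<^bsub>K\<^esub> cls f = cls (\<lambda>n. s k n - f k) \<oplus>\<^bsub>K\<^esub> cls (\<lambda>n. f k - f n)"
        by (simp add: s minus_K add_K f is_cauchy_intros)
      then have "nrm K (\<sigma> k \<ominus>\<^bsub>K\<^esub> cls f)
          \<le> nrm K (cls (\<lambda>n. s k n - f k)) + nrm K (cls (\<lambda>n. f k - f n))"
        using nrm_K_add by (simp add: s f is_cauchy_intros)
      also have "nrm K (cls (\<lambda>n. f k - f n)) \<le> e / 3"
        using M2 that by (intro nrm_K_le[where N = M2]) (auto simp: f is_cauchy_intros intro: less_imp_le)
      also have "nrm K (cls (\<lambda>n. s k n - f k)) < e / 3"
        using approx[of k] M1 that by (meson le_less_trans max.boundedE)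
      moreover have "0 \<le> nrm K (\<sigma> k \<ominus>\<^bsub>K\<^esub> cls f)"
        by (intro nrm_K_nonneg minus_closed carr cls_carrier f)
      ultimately show ?thesis using \<open>e > 0\<close> by simp
    qed
    then show "\<exists>M. \<forall>k\<ge>M. norm (nrm K (\<sigma> k \<ominus>\<^bsub>K\<^esub> cls f) - 0) < e" by blast
  qed
  then show ?thesis using f by blast
qed

theorem completion_cstar: "unital_cstar_algebra K"
proof (intro unital_cstar_algebra.intro ring_K unital_cstar_algebra_axioms.intro)
  fix x y c d
  assume x: "x \<in> carrier K"
  then obtain s where s: "is_cauchy s" "x = cls s" by (rule K_cases)
  note K_simps = scale_K adj_K add_K mult_K is_cauchy_intros free_scale_simps
    free_scale_mult_right free_adj_adj free_adj_add free_adj_mult free_adj_scale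
  show "scale K c x \<in> carrier K" "scale K 1 x = x" "scale K c (scale K d x) = scale K (c * d) x"
    "scale K (c + d) x = scale K c x \<oplus>\<^bsub>K\<^esub> scale K d x"
    "adj K x \<in> carrier K" "adj K (adj K x) = x" "adj K (scale K c x) = scale K (cnj c) (adj K x)"
    by (simp_all add: s K_simps)
  show "0 \<le> nrm K x" "nrm K x = 0 \<longleftrightarrow> x = \<zero>\<^bsub>K\<^esub>" "nrm K (scale K c x) = cmod c * nrm K x"
    "nrm K (adj K x \<otimes>\<^bsub>K\<^esub> x) = (nrm K x)\<^sup>2"
    using x by (rule nrm_K_nonneg nrm_K_eq_0 nrm_K_scale adj_nrm_K)+
  assume y: "y \<in> carrier K"
  then obtain t where t: "is_cauchy t" "y = cls t" by (rule K_cases)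
  show "scale K c (x \<oplus>\<^bsub>K\<^esub> y) = scale K c x \<oplus>\<^bsub>K\<^esub> scale K c y"
    "scale K c x \<otimes>\<^bsub>K\<^esub> y = scale K c (x \<otimes>\<^bsub>K\<^esub> y)" "x \<otimes>\<^bsub>K\<^esub> scale K c y = scale K c (x \<otimes>\<^bsub>K\<^esub> y)"
    "adj K (x \<oplus>\<^bsub>K\<^esub> y) = adj K x \<oplus>\<^bsub>K\<^esub> adj K y" "adj K (x \<otimes>\<^bsub>K\<^esub> y) = adj K y \<otimes>\<^bsub>K\<^esub> adj K x"
    by (simp_all add: s t K_simps)
  show "nrm K (x \<oplus>\<^bsub>K\<^esub> y) \<le> nrm K x + nrm K y" "nrm K (x \<otimes>\<^bsub>K\<^esub> y) \<le> nrm K x * nrm K y"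
    using x y by (rule nrm_K_add nrm_K_mult)+
qed (rule complete_K)

end


context cstar_seminorm_loc
begin

lemma embed_closed [simp, intro]: "free_embed \<nu> f \<in> carrier K"
  by (auto simp: free_embed_def)

lemma embed_add: "free_embed \<nu> (f + g) = free_embed \<nu> f \<oplus>\<^bsub>K\<^esub> free_embed \<nu> g"
  by (simp add: free_embed_def add_K)

lemma embed_mult: "free_embed \<nu> (f * g) = free_embed \<nu> f \<otimes>\<^bsub>K\<^esub> free_embed \<nu> g"
  by (simp add: free_embed_def mult_K)

lemma embed_one: "free_embed \<nu> 1 = \<one>\<^bsub>K\<^esub>"
  by (simp add: free_embed_def one_K)

lemma embed_scale: "free_embed \<nu> (free_scale c f) = scale K c (free_embed \<nu> f)"
  by (simp add: free_embed_def scale_K)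

lemma embed_adj: "free_embed \<nu> (free_adj f) = adj K (free_embed \<nu> f)"
  by (simp add: free_embed_def adj_K)

lemma embed_nrm: "nrm K (free_embed \<nu> f) = \<nu> f"
  by (simp add: free_embed_def nrm_K_eq)

lemma embed_eq_iff: "free_embed \<nu> f = free_embed \<nu> g \<longleftrightarrow> \<nu> (f - g) = 0"
  by (simp add: free_embed_def cls_eq_iff LIMSEQ_const_iff)

lemma embed_zero: "free_embed \<nu> 0 = \<zero>\<^bsub>K\<^esub>"
  by (simp add: free_embed_def zero_K)

lemma embed_sum:
  assumes "finite S"
  shows "free_embed \<nu> (sum f S) = finsum K (\<lambda>i. free_embed \<nu> (f i)) S"
proof -
  interpret ring K by (rule ring_K)
  show ?thesis
    using assms by (induction S) (simp_all add: embed_zero embed_add Pi_def)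
qed

lemma embed_dense:
  assumes "z \<in> carrier K" "e > 0" shows "\<exists>f. nrm K (z \<ominus>\<^bsub>K\<^esub> free_embed \<nu> f) < e"
proof -
  obtain s where s: "is_cauchy s" "z = cls s" using assms(1) by (rule K_cases)
  from s(1) obtain N where N: "\<forall>m\<ge>N. \<forall>n\<ge>N. \<nu> (s m - s n) < e / 2"
    using assms(2) unfolding is_cauchy_iff by (meson half_gt_zero)
  have "nrm K (z \<ominus>\<^bsub>K\<^esub> free_embed \<nu> (s N)) \<le> e / 2"
    unfolding free_embed_def s(2) minus_K[OF s(1) is_cauchy_const]
    using N by (intro nrm_K_le[where N = N]) (auto simp: s is_cauchy_intros intro: less_imp_le)
  then show ?thesis using assms(2) by (intro exI[of _ "s N"]) simp
qed

end


subsection \<open>Limits and evaluation of *-polynomials in a unital C*-algebra\<close>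

context unital_cstar_algebra
begin

lemma nrm_zero: "nrm C \<zero> = 0"
  by (simp add: nrm_eq_0)

lemma scale_zero: "scale C c \<zero> = \<zero>"
  using nrm_scale[of \<zero> c] by (simp add: nrm_zero nrm_eq_0 scale_closed)

lemma scale_0: "x \<in> carrier C \<Longrightarrow> scale C 0 x = \<zero>"
  using nrm_scale[of x 0] by (simp add: nrm_eq_0 scale_closed)

lemma scale_minus1: "x \<in> carrier C \<Longrightarrow> scale C (-1) x = \<ominus> x"
  using scale_add_left[of x "-1" 1]
  by (metis add.inv_closed add.right_inverse minus_equality scale_0 scale_closed scale_one
      add.left_neutral ab_left_minus)

lemma nrm_minus: "x \<in> carrier C \<Longrightarrow> nrm C (\<ominus> x) = nrm C x"
  using nrm_scale[of x "-1"] by (simp add: scale_minus1)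

lemma adj_one: "adj C \<one> = \<one>"
  using adj_mult[of "adj C \<one>" \<one>] by (simp add: adj_closed adj_adj)

lemma adj_zero: "adj C \<zero> = \<zero>"
  using adj_scale[of \<zero> 0] by (simp add: scale_0 adj_closed)

lemma nrm_adj_le: "x \<in> carrier C \<Longrightarrow> nrm C x \<le> nrm C (adj C x)"
proof (cases "nrm C x = 0")
  case False
  assume x: "x \<in> carrier C"
  then have "(nrm C x)\<^sup>2 \<le> nrm C (adj C x) * nrm C x"
    using cstar_identity[of x] nrm_mult[of "adj C x" x] by (simp add: adj_closed)
  then show ?thesis
    using False nrm_nonneg[OF x] by (simp add: power2_eq_square)
qed (simp add: nrm_nonneg adj_closed)

lemma nrm_adj: "x \<in> carrier C \<Longrightarrow> nrm C (adj C x) = nrm C x"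
  using nrm_adj_le[of x] nrm_adj_le[of "adj C x"] by (simp add: adj_closed adj_adj)

lemma scale_minus: "x \<in> carrier C \<Longrightarrow> y \<in> carrier C \<Longrightarrow>
    scale C c (x \<ominus> y) = scale C c x \<ominus> scale C c y"
  by (simp add: minus_eq scale_add_right scale_closed scale_scale mult.commute flip: scale_minus1)

lemma adj_minus: "x \<in> carrier C \<Longrightarrow> y \<in> carrier C \<Longrightarrow> adj C (x \<ominus> y) = adj C x \<ominus> adj C y"
  by (simp add: minus_eq adj_add scale_closed adj_closed adj_scale flip: scale_minus1)

definition conv :: "(nat \<Rightarrow> 'c) \<Rightarrow> 'c \<Rightarrow> bool" where
  "conv \<sigma> x \<longleftrightarrow> (\<forall>n. \<sigma> n \<in> carrier C) \<and> x \<in> carrier C \<and> (\<lambda>n. nrm C (\<sigma> n \<ominus> x)) \<longlonglongrightarrow> 0"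

lemma convI:
  assumes "\<And>n. \<sigma> n \<in> carrier C" "x \<in> carrier C" "B \<longlonglongrightarrow> 0" "\<And>n. nrm C (\<sigma> n \<ominus> x) \<le> B n"
  shows "conv \<sigma> x"
  unfolding conv_def using assms
  by (auto intro!: tendsto_sandwich[OF _ _ tendsto_const assms(3)] simp: nrm_nonneg)

lemma conv_const: "x \<in> carrier C \<Longrightarrow> conv (\<lambda>n. x) x"
  by (simp add: conv_def minus_eq r_neg nrm_zero)

lemma conv_add:
  assumes "conv \<sigma> x" "conv \<tau> y" shows "conv (\<lambda>n. \<sigma> n \<oplus> \<tau> n) (x \<oplus> y)"
proof (rule convI)
  note * = assms[unfolded conv_def]
  show "(\<lambda>n. nrm C (\<sigma> n \<ominus> x) + nrm C (\<tau> n \<ominus> y)) \<longlonglongrightarrow> 0"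
    using * by (intro tendsto_add_zero) auto
  fix n
  have c: "\<sigma> n \<in> carrier C" "\<tau> n \<in> carrier C" "x \<in> carrier C" "y \<in> carrier C" using * by auto
  then have "\<sigma> n \<oplus> \<tau> n \<ominus> (x \<oplus> y) = (\<sigma> n \<ominus> x) \<oplus> (\<tau> n \<ominus> y)" by algebra
  then show "nrm C (\<sigma> n \<oplus> \<tau> n \<ominus> (x \<oplus> y)) \<le> nrm C (\<sigma> n \<ominus> x) + nrm C (\<tau> n \<ominus> y)"
    using c by (simp add: nrm_add)
qed (use assms in \<open>auto simp: conv_def\<close>)

lemma conv_scale:
  assumes "conv \<sigma> x" shows "conv (\<lambda>n. scale C c (\<sigma> n)) (scale C c x)"
  using assms
  by (auto simp: conv_def scale_closed nrm_scale intro: tendsto_mult_right_zero simp flip: scale_minus)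

lemma conv_adj:
  assumes "conv \<sigma> x" shows "conv (\<lambda>n. adj C (\<sigma> n)) (adj C x)"
  using assms by (auto simp: conv_def adj_closed nrm_adj simp flip: adj_minus)

lemma conv_nrm:
  assumes "conv \<sigma> x" shows "(\<lambda>n. nrm C (\<sigma> n)) \<longlonglongrightarrow> nrm C x"
proof -
  note * = assms[unfolded conv_def]
  have "(\<lambda>n. nrm C (\<sigma> n) - nrm C x) \<longlonglongrightarrow> 0"
  proof (rule Lim_null_comparison)
    show "(\<lambda>n. nrm C (\<sigma> n \<ominus> x)) \<longlonglongrightarrow> 0" using * by simp
    have "\<bar>nrm C (\<sigma> n) - nrm C x\<bar> \<le> nrm C (\<sigma> n \<ominus> x)" for n
    proof -
      have c: "\<sigma> n \<in> carrier C" "x \<in> carrier C" using * by auto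
      then have "\<sigma> n = (\<sigma> n \<ominus> x) \<oplus> x" "x = \<ominus> (\<sigma> n \<ominus> x) \<oplus> \<sigma> n" by algebra+
      then have "nrm C (\<sigma> n) \<le> nrm C (\<sigma> n \<ominus> x) + nrm C x"
        "nrm C x \<le> nrm C (\<ominus> (\<sigma> n \<ominus> x)) + nrm C (\<sigma> n)"
        using c by (metis nrm_add minus_closed a_inv_closed)+
      then show ?thesis using c by (simp add: nrm_minus)
    qed
    then show "\<forall>\<^sub>F n in sequentially. norm (nrm C (\<sigma> n) - nrm C x) \<le> nrm C (\<sigma> n \<ominus> x)"
      by simp
  qed
  then show ?thesis by (rule LIM_zero_cancel)
qed

lemma conv_mult:
  assumes "conv \<sigma> x" "conv \<tau> y" shows "conv (\<lambda>n. \<sigma> n \<otimes> \<tau> n) (x \<otimes> y)"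
proof (rule convI)
  note * = assms[unfolded conv_def]
  have "(\<lambda>n. nrm C (\<sigma> n \<ominus> x) * nrm C (\<tau> n) + nrm C x * nrm C (\<tau> n \<ominus> y)) \<longlonglongrightarrow> 0 * nrm C y + nrm C x * 0"
    using * by (intro tendsto_intros conv_nrm[OF assms(2)]) auto
  then show "(\<lambda>n. nrm C (\<sigma> n \<ominus> x) * nrm C (\<tau> n) + nrm C x * nrm C (\<tau> n \<ominus> y)) \<longlonglongrightarrow> 0" by simp
  fix n
  have c: "\<sigma> n \<in> carrier C" "\<tau> n \<in> carrier C" "x \<in> carrier C" "y \<in> carrier C" using * by auto
  then have "\<sigma> n \<otimes> \<tau> n \<ominus> (x \<otimes> y) = (\<sigma> n \<ominus> x) \<otimes> \<tau> n \<oplus> x \<otimes> (\<tau> n \<ominus> y)" by algebra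
  then have "nrm C (\<sigma> n \<otimes> \<tau> n \<ominus> (x \<otimes> y)) \<le> nrm C ((\<sigma> n \<ominus> x) \<otimes> \<tau> n) + nrm C (x \<otimes> (\<tau> n \<ominus> y))"
    using c by (simp add: nrm_add)
  also have "\<dots> \<le> nrm C (\<sigma> n \<ominus> x) * nrm C (\<tau> n) + nrm C x * nrm C (\<tau> n \<ominus> y)"
    using c by (intro add_mono nrm_mult) auto
  finally show "nrm C (\<sigma> n \<otimes> \<tau> n \<ominus> (x \<otimes> y)) \<le> nrm C (\<sigma> n \<ominus> x) * nrm C (\<tau> n) + nrm C x * nrm C (\<tau> n \<ominus> y)" .
qed (use assms in \<open>auto simp: conv_def\<close>)

lemma conv_unique:
  assumes "conv \<sigma> x" "conv \<tau> y" "(\<lambda>n. nrm C (\<sigma> n \<ominus> \<tau> n)) \<longlonglongrightarrow> 0" shows "x = y"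
proof -
  have "conv (\<lambda>n. \<sigma> n \<oplus> scale C (-1) (\<tau> n)) (x \<oplus> scale C (-1) y)"
    by (intro conv_add conv_scale assms)
  then have "conv (\<lambda>n. \<sigma> n \<ominus> \<tau> n) (x \<ominus> y)"
    using assms(1,2) by (simp add: conv_def scale_minus1 minus_eq)
  from LIMSEQ_unique[OF conv_nrm[OF this] assms(3)] have "x \<ominus> y = \<zero>"
    using assms(1,2) by (simp add: conv_def nrm_eq_0)
  moreover have "x = (x \<ominus> y) \<oplus> y"
    using assms(1,2) by (simp add: conv_def minus_eq a_assoc l_neg)
  ultimately show ?thesis
    using assms(2) by (simp add: conv_def)
qed

fun word_val :: "('g \<Rightarrow> 'c) \<Rightarrow> 'g list \<Rightarrow> 'c" where
  "word_val e [] = \<one>"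
| "word_val e (g # ws) = e g \<otimes> word_val e ws"

definition poly_val :: "('g \<Rightarrow> 'c) \<Rightarrow> 'g free_alg \<Rightarrow> 'c" where
  "poly_val e f = finsum C (\<lambda>w. scale C (Poly_Mapping.lookup f w) (word_val e (letters w)))
     (Poly_Mapping.keys f)"

context
  fixes e :: "'g \<Rightarrow> 'c"
  assumes e_closed: "\<And>g. e g \<in> carrier C" and e_adj: "\<And>g. adj C (e g) = e g"
begin

lemma word_val_closed [simp, intro]: "word_val e ws \<in> carrier C"
  by (induction ws) (auto simp: e_closed)

lemma word_val_append: "word_val e (us @ vs) = word_val e us \<otimes> word_val e vs"
  by (induction us) (auto simp: e_closed m_assoc)

lemma adj_word_val: "adj C (word_val e ws) = word_val e (rev ws)"
  by (induction ws) (auto simp: adj_one adj_mult e_closed e_adj word_val_append)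

lemma poly_val_superset:
  assumes "finite S" "Poly_Mapping.keys f \<subseteq> S"
  shows "poly_val e f = finsum C (\<lambda>w. scale C (Poly_Mapping.lookup f w) (word_val e (letters w))) S"
  unfolding poly_val_def
  by (rule add.finprod_mono_neutral_cong_left)
     (use assms in \<open>auto simp: scale_closed scale_0 not_in_keys_iff_lookup_eq_zero\<close>)

lemma poly_val_closed [simp, intro]: "poly_val e f \<in> carrier C"
  unfolding poly_val_def by (intro finsum_closed) (auto simp: scale_closed)

lemma poly_val_add: "poly_val e (f + g) = poly_val e f \<oplus> poly_val e g"
proof -
  let ?S = "Poly_Mapping.keys f \<union> Poly_Mapping.keys g"
  let ?v = "\<lambda>f w. scale C (Poly_Mapping.lookup f w) (word_val e (letters w))"
  have "poly_val e (f + g) = finsum C (?v (f + g)) ?S"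
    by (rule poly_val_superset) (auto dest: Poly_Mapping.keys_add[THEN subsetD])
  also have "\<dots> = finsum C (\<lambda>w. ?v f w \<oplus> ?v g w) ?S"
    by (simp add: lookup_add scale_add_left)
  also have "\<dots> = finsum C (?v f) ?S \<oplus> finsum C (?v g) ?S"
    by (rule finsum_addf) (auto simp: scale_closed)
  also have "\<dots> = poly_val e f \<oplus> poly_val e g"
    by (simp add: poly_val_superset[symmetric])
  finally show ?thesis .
qed

lemma poly_val_0: "poly_val e 0 = \<zero>"
  by (simp add: poly_val_def)

lemma poly_val_single: "poly_val e (Poly_Mapping.single w c) = scale C c (word_val e (letters w))"
  using poly_val_superset[of "{w}" "Poly_Mapping.single w c"] by (simp add: scale_closed)

lemma poly_val_1: "poly_val e 1 = \<one>"
  using poly_val_single[of 0 1] by (simp add: scale_one zero_word_def flip: single_one)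

lemma poly_val_gen: "poly_val e (free_gen g) = e g"
  by (simp add: free_gen_def poly_val_single scale_one e_closed)

lemma poly_val_scale: "poly_val e (free_scale c f) = scale C c (poly_val e f)"
proof (induction f rule: free_alg_induct)
  case zero
  have "free_scale c 0 = (0 :: 'g free_alg)" by (simp add: free_scale_eq)
  then show ?case by (simp add: poly_val_0 scale_zero)
qed (simp_all add: free_scale_single poly_val_single scale_scale free_scale_simps poly_val_add scale_add_right)

lemma poly_val_mult: "poly_val e (f * g) = poly_val e f \<otimes> poly_val e g"
proof (induction f rule: free_alg_induct)
  case (single w c)
  show ?case
    by (induction g rule: free_alg_induct)
       (simp_all add: poly_val_0 mult_single poly_val_single scale_mult_left scale_mult_right scale_closed
         scale_scale plus_word_def word_val_append distrib_left poly_val_add r_distr mult.commute)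
qed (simp_all add: poly_val_0 distrib_right poly_val_add l_distr)

lemma poly_val_adj: "poly_val e (free_adj f) = adj C (poly_val e f)"
  by (induction f rule: free_alg_induct)
     (simp_all add: free_adj_0 poly_val_0 adj_zero free_adj_single poly_val_single adj_scale adj_word_val
       word_rev_def free_adj_add poly_val_add adj_add)

lemma poly_val_diff: "poly_val e (f - g) = poly_val e f \<ominus> poly_val e g"
proof -
  have "poly_val e (f - g) \<oplus> poly_val e g = poly_val e f"
    by (simp flip: poly_val_add)
  moreover have "poly_val e (f - g) = (poly_val e (f - g) \<oplus> poly_val e g) \<ominus> poly_val e g"
    by (simp add: minus_eq a_assoc r_neg)
  ultimately show ?thesis by simp
qed

lemma poly_val_sum:
  "finite S \<Longrightarrow> poly_val e (sum f S) = finsum C (\<lambda>i. poly_val e (f i)) S"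
  by (induction S rule: finite_induct) (simp_all add: poly_val_0 poly_val_add)

lemma poly_val_seminorm: "cstar_seminorm (\<lambda>f. nrm C (poly_val e f))"
  unfolding cstar_seminorm_def
  by (auto simp: nrm_nonneg poly_val_add nrm_add poly_val_scale nrm_scale poly_val_mult nrm_mult
      poly_val_adj cstar_identity)

lemma extend_to_completion:
  assumes "cstar_seminorm \<nu>" and le: "\<And>f. nrm C (poly_val e f) \<le> \<nu> f"
  shows "\<exists>h \<in> unital_star_hom (cstar_completion \<nu>) C. \<forall>f. h (free_embed \<nu> f) = poly_val e f"
proof -
  interpret V: cstar_seminorm_loc \<nu> by standard fact
  define h where "h z = (SOME x. \<exists>s. V.is_cauchy s \<and> z = V.cls s \<and> conv (\<lambda>n. poly_val e (s n)) x)" for z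
  have lim: "conv (\<lambda>n. poly_val e (s n)) (h (V.cls s))" if s: "V.is_cauchy s" for s
  proof -
    have "\<exists>x \<in> carrier C. (\<lambda>n. nrm C (poly_val e (s n) \<ominus> x)) \<longlonglongrightarrow> 0"
    proof (rule complete)
      fix r :: real assume "r > 0"
      then obtain N where "\<forall>m\<ge>N. \<forall>n\<ge>N. \<nu> (s m - s n) < r"
        using s unfolding V.is_cauchy_iff by blast
      then show "\<exists>N. \<forall>m\<ge>N. \<forall>n\<ge>N. nrm C (poly_val e (s m) \<ominus> poly_val e (s n)) < r"
        using le by (metis le_less_trans poly_val_diff)
    qed auto
    then obtain x where "conv (\<lambda>n. poly_val e (s n)) x" by (auto simp: conv_def)
    then have "\<exists>x t. V.is_cauchy t \<and> V.cls s = V.cls t \<and> conv (\<lambda>n. poly_val e (t n)) x"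
      using s by blast
    then have "\<exists>t. V.is_cauchy t \<and> V.cls s = V.cls t \<and> conv (\<lambda>n. poly_val e (t n)) (h (V.cls s))"
      unfolding h_def by (rule someI_ex)
    then obtain t where t: "V.cls s = V.cls t" "conv (\<lambda>n. poly_val e (t n)) (h (V.cls s))"
      by blast
    from t(1) have null: "(\<lambda>n. \<nu> (s n - t n)) \<longlonglongrightarrow> 0" by (simp only: V.cls_eq_iff)
    have "(\<lambda>n. nrm C (poly_val e (s n) \<ominus> poly_val e (t n))) \<longlonglongrightarrow> 0"
      by (rule tendsto_sandwich[OF _ _ tendsto_const null])
         (simp_all add: nrm_nonneg le flip: poly_val_diff)
    from conv_unique[OF \<open>conv (\<lambda>n. poly_val e (s n)) x\<close> t(2) this]
    show ?thesis using \<open>conv (\<lambda>n. poly_val e (s n)) x\<close> by simp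
  qed
  have eqI: "h (V.cls s) = x" if "V.is_cauchy s" "conv (\<lambda>n. poly_val e (s n)) x" for s x
    by (rule conv_unique[OF lim[OF that(1)] that(2)])
       (simp add: minus_eq r_neg nrm_zero)
  have emb: "h (free_embed \<nu> f) = poly_val e f" for f
    unfolding free_embed_def by (intro eqI V.is_cauchy_const conv_const poly_val_closed)
  have "h \<in> unital_star_hom V.K C"
    unfolding unital_star_hom_def
  proof (intro CollectI conjI allI ballI ring_hom_memI)
    fix x assume "x \<in> carrier V.K"
    then obtain s where s: "V.is_cauchy s" "x = V.cls s" by (rule V.K_cases)
    note ls = lim[OF s(1)]
    show "h x \<in> carrier C" using ls by (simp add: conv_def s)
    show "h (scale V.K c x) = scale C c (h x)" for c
      unfolding s V.scale_K
      by (intro eqI V.is_cauchy_intros s) (simp add: poly_val_scale conv_scale ls)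
    show "h (adj V.K x) = adj C (h x)"
      unfolding s V.adj_K
      by (intro eqI V.is_cauchy_intros s) (simp add: poly_val_adj conv_adj ls)
    fix y assume "y \<in> carrier V.K"
    then obtain t where t: "V.is_cauchy t" "y = V.cls t" by (rule V.K_cases)
    note lt = lim[OF t(1)]
    show "h (x \<otimes>\<^bsub>V.K\<^esub> y) = h x \<otimes> h y"
      unfolding s t V.mult_K[OF s(1) t(1)]
      by (intro eqI V.is_cauchy_intros s t) (simp add: poly_val_mult conv_mult ls lt)
    show "h (x \<oplus>\<^bsub>V.K\<^esub> y) = h x \<oplus> h y"
      unfolding s t V.add_K[OF s(1) t(1)]
      by (intro eqI V.is_cauchy_intros s t) (simp add: poly_val_add conv_add ls lt)
  next
    show "h \<one>\<^bsub>V.K\<^esub> = \<one>"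
      using emb[of 1] by (simp add: V.embed_one poly_val_1)
  qed
  with emb show ?thesis by blast
qed

end

end


subsection \<open>The universal property of the game C*-algebra\<close>

lemma complex_cstar_unital_cstar_algebra: "unital_cstar_algebra complex_cstar"
proof -
  have "ring complex_cstar"
  proof (rule ringI)
    show "abelian_group complex_cstar"
    proof (rule abelian_groupI)
      fix x assume "x \<in> carrier complex_cstar"
      then show "\<exists>y\<in>carrier complex_cstar. y \<oplus>\<^bsub>complex_cstar\<^esub> x = \<zero>\<^bsub>complex_cstar\<^esub>"
        by (intro bexI[of _ "- x"]) (auto simp: complex_cstar_def)
    qed (auto simp: complex_cstar_def)
    show "Group.monoid complex_cstar"
      by (rule monoidI) (auto simp: complex_cstar_def)
  qed (auto simp: complex_cstar_def algebra_simps)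
  then interpret ring complex_cstar .
  have minus: "x \<ominus>\<^bsub>complex_cstar\<^esub> y = x - y" for x y
  proof -
    have "\<ominus>\<^bsub>complex_cstar\<^esub> y = - y"
      by (rule minus_equality) (auto simp: complex_cstar_def)
    then show ?thesis by (simp add: minus_eq) (simp add: complex_cstar_def)
  qed
  show ?thesis
  proof (intro unital_cstar_algebra.intro unital_cstar_algebra_axioms.intro ring_axioms)
    fix \<sigma> :: "nat \<Rightarrow> complex"
    assume "\<And>e. 0 < e \<Longrightarrow> \<exists>N. \<forall>m\<ge>N. \<forall>n\<ge>N. nrm complex_cstar (\<sigma> m \<ominus>\<^bsub>complex_cstar\<^esub> \<sigma> n) < e"
    then have "Cauchy \<sigma>"
      by (simp add: Cauchy_def minus dist_norm) (simp add: complex_cstar_def)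
    then obtain x where "\<sigma> \<longlonglongrightarrow> x" using Cauchy_convergent convergentD by blast
    then have "(\<lambda>n. nrm complex_cstar (\<sigma> n \<ominus>\<^bsub>complex_cstar\<^esub> x)) \<longlonglongrightarrow> 0"
      by (simp add: minus) (simp add: complex_cstar_def tendsto_norm_zero LIM_zero)
    then show "\<exists>x\<in>carrier complex_cstar. (\<lambda>n. nrm complex_cstar (\<sigma> n \<ominus>\<^bsub>complex_cstar\<^esub> x)) \<longlonglongrightarrow> 0"
      by (intro bexI[of _ x]) (simp_all add: complex_cstar_def)
  qed (auto simp: complex_cstar_def algebra_simps norm_mult norm_triangle_ineq power2_eq_square)
qed

definition game_family ::
  "('c, 'm) star_algebra_scheme \<Rightarrow> ('x::finite, 'y::finite, 'a::finite, 'b::finite) rule \<Rightarrow>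
     ('x \<Rightarrow> 'a \<Rightarrow> 'c) \<Rightarrow> ('y \<Rightarrow> 'b \<Rightarrow> 'c) \<Rightarrow> bool" where
  "game_family C lam p q \<longleftrightarrow>
     (\<forall>x a. p x a \<in> carrier C \<and> p x a \<otimes>\<^bsub>C\<^esub> p x a = p x a \<and> adj C (p x a) = p x a) \<and>
     (\<forall>y b. q y b \<in> carrier C \<and> q y b \<otimes>\<^bsub>C\<^esub> q y b = q y b \<and> adj C (q y b) = q y b) \<and>
     (\<forall>x. finsum C (p x) UNIV = \<one>\<^bsub>C\<^esub>) \<and> (\<forall>y. finsum C (q y) UNIV = \<one>\<^bsub>C\<^esub>) \<and>
     (\<forall>x y a b. lam x y a b = 0 \<longrightarrow> p x a \<otimes>\<^bsub>C\<^esub> q y b = \<zero>\<^bsub>C\<^esub>)"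

theorem game_cstar_unital_cstar_algebra: "unital_cstar_algebra (game_cstar lam)"
proof -
  interpret cstar_seminorm_loc "game_seminorm lam"
    by unfold_locales (use game_seminorm_admissible in \<open>auto simp: admissible_seminorms_def\<close>)
  show ?thesis unfolding game_cstar_def by (rule completion_cstar)
qed

theorem game_cstar_family:
  "game_family (game_cstar lam) lam
     (\<lambda>x a. free_embed (game_seminorm lam) (free_gen (GenP x a)))
     (\<lambda>y b. free_embed (game_seminorm lam) (free_gen (GenQ y b)))"
proof -
  interpret cstar_seminorm_loc "game_seminorm lam"
    by unfold_locales (use game_seminorm_admissible in \<open>auto simp: admissible_seminorms_def\<close>)
  have *: "game_seminorm lam r = 0" if "r \<in> game_relations lam" for r
    using game_seminorm_admissible that by (auto simp: admissible_seminorms_def)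
  note rels = game_relations_def[of lam, unfolded Let_def]
  have pp: "game_seminorm lam (free_gen (GenP x a) * free_gen (GenP x a) - free_gen (GenP x a)) = 0" for x a
    by (rule *) (unfold rels, blast)
  have qq: "game_seminorm lam (free_gen (GenQ y b) * free_gen (GenQ y b) - free_gen (GenQ y b)) = 0" for y b
    by (rule *) (unfold rels, blast)
  have sp: "game_seminorm lam ((\<Sum>a\<in>UNIV. free_gen (GenP x a)) - 1) = 0" for x
    by (rule *) (unfold rels, blast)
  have sq: "game_seminorm lam ((\<Sum>b\<in>UNIV. free_gen (GenQ y b)) - 1) = 0" for y
    by (rule *) (unfold rels, blast)
  have pq: "game_seminorm lam (free_gen (GenP x a) * free_gen (GenQ y b)) = 0"
    if "lam x y a b = 0" for x y a b
    by (rule *) (use that in \<open>unfold rels, blast\<close>)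
  show ?thesis
    unfolding game_family_def game_cstar_def
    unfolding embed_mult[symmetric] embed_adj[symmetric] embed_one[symmetric] embed_zero[symmetric]
      embed_sum[OF finite, symmetric] embed_eq_iff
    by (simp add: pp qq sp sq pq)
qed

theorem game_cstar_generated:
  assumes "z \<in> carrier (game_cstar lam)" "e > 0"
  shows "\<exists>f. nrm (game_cstar lam) (z \<ominus>\<^bsub>game_cstar lam\<^esub> free_embed (game_seminorm lam) f) < e"
proof -
  interpret cstar_seminorm_loc "game_seminorm lam"
    by unfold_locales (use game_seminorm_admissible in \<open>auto simp: admissible_seminorms_def\<close>)
  show ?thesis using assms unfolding game_cstar_def by (rule embed_dense)
qed

theorem game_cstar_universal:
  assumes "unital_cstar_algebra D" "game_family D lam p q"
  shows "\<exists>h \<in> unital_star_hom (game_cstar lam) D.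
     (\<forall>x a. h (free_embed (game_seminorm lam) (free_gen (GenP x a))) = p x a) \<and>
     (\<forall>y b. h (free_embed (game_seminorm lam) (free_gen (GenQ y b))) = q y b)"
proof -
  interpret D: unital_cstar_algebra D by fact
  note fam = assms(2)[unfolded game_family_def]
  define e where "e g = (case g of GenP x a \<Rightarrow> p x a | GenQ y b \<Rightarrow> q y b)" for g
  have e: "e g \<in> carrier D" "adj D (e g) = e g" for g
    using fam by (cases g; simp add: e_def)+
  have e_gen: "e (GenP x a) = p x a" "e (GenQ y b) = q y b" for x y a b
    by (simp_all add: e_def)
  note val = D.poly_val_add[where e = e, OF e] D.poly_val_mult[where e = e, OF e] D.poly_val_diff[where e = e, OF e] D.poly_val_1[where e = e, OF e]
    D.poly_val_gen[where e = e, OF e] D.poly_val_sum[where e = e, OF e finite]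
  have "D.poly_val e r = \<zero>\<^bsub>D\<^esub>" if "r \<in> game_relations lam" for r
    using that fam
    by (auto simp: game_relations_def Let_def val e_gen D.minus_eq D.r_neg)
  then have "(\<lambda>f. nrm D (D.poly_val e f)) \<in> admissible_seminorms (game_relations lam)"
    by (auto simp: admissible_seminorms_def D.poly_val_seminorm[where e = e, OF e] D.nrm_zero)
  then have "nrm D (D.poly_val e f) \<le> game_seminorm lam f" for f
    by (rule game_seminorm_ge[of "\<lambda>f. nrm D (D.poly_val e f)"])
  moreover have "cstar_seminorm (game_seminorm lam)"
    using game_seminorm_admissible by (auto simp: admissible_seminorms_def)
  ultimately obtain h where h: "h \<in> unital_star_hom (game_cstar lam) D"
      "\<And>f. h (free_embed (game_seminorm lam) f) = D.poly_val e f"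
    using D.extend_to_completion[where e = e, OF e] unfolding game_cstar_def by blast
  show ?thesis
    by (rule bexI[OF _ h(1)]) (simp add: h(2) D.poly_val_gen[where e = e, OF e], simp add: e_def)
qed

end

theory Submission
  imports Defs "HOL-Algebra.UnivPoly"
begin

text \<open>
  Both sides say that the players can win with certainty by deterministic answers: there are
  functions \<open>f\<close> from \<open>X\<close> to \<open>A\<close> and \<open>g\<close> from \<open>Y\<close> to \<open>B\<close> with \<open>lam x y (f x) (g y) \<noteq> 0\<close> for all
  \<open>x\<close> and \<open>y\<close>.

  A product of probability distributions charges, for every pair of questions at once, the answers
  of some such pair \<open>(f, g)\<close>: choose \<open>f x\<close> and \<open>g y\<close> in the supports of the two marginals. This
  property passes to convex combinations because nothing cancels between nonnegative families, so
  every local correlation has it (\<open>local_correlation_charges_deterministic\<close>), and perfection forces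
  the charged answers to win. The indicator functions of the graphs of \<open>f\<close> and \<open>g\<close> are then scalar
  projections that satisfy the relations of the game, and the universal property of the game
  C*-algebra turns them into a character.

  Conversely, a character maps the generators to scalar projections that satisfy the relations of
  the game. Idempotent scalars are 0 or 1, so these values are probability distributions on the
  answers, and their products form a local correlation; it is perfect since
  \<open>p\<^sub>x\<^sub>,\<^sub>a q\<^sub>y\<^sub>,\<^sub>b = 0\<close> holds for the losing answers.
\<close>

lemma exists_pos_of_sum_one:
  fixes d :: "'i::finite \<Rightarrow> real"
  assumes "\<forall>i. 0 \<le> d i" "(\<Sum>i\<in>UNIV. d i) = 1"
  shows "\<exists>i. 0 < d i"
proof (rule ccontr)
  assume "\<nexists>i. 0 < d i"
  then have "d i = 0" for i using assms(1) by (metis antisym_conv2)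
  then show False using assms(2) by simp
qed

text \<open>The property is chosen so that it is preserved by convex combinations: the positive values
  of one family with positive weight survive, since no family has negative entries. Hence the
  convex hull never has to be decomposed into finitely many product families.\<close>

lemma local_correlation_charges_deterministic:
  fixes p :: "real ^ ('a::finite \<times> 'b::finite \<times> 'x::finite \<times> 'y::finite)"
  assumes "p \<in> local_correlations"
  shows "\<exists>f g. \<forall>x y. 0 < p $ (f x, g y, x, y)"
proof -
  define S :: "(real ^ ('a \<times> 'b \<times> 'x \<times> 'y)) set"
    where "S = {p. (\<forall>i. 0 \<le> p $ i) \<and> (\<exists>f g. \<forall>x y. 0 < p $ (f x, g y, x, y))}"
  have "convex S"
    unfolding convex_alt
  proof (intro ballI allI impI)
    fix v w and u :: real
    assume v: "v \<in> S" and w: "w \<in> S" and u: "0 \<le> u \<and> u \<le> 1"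
    have nonneg: "\<forall>i. 0 \<le> v $ i" "\<forall>i. 0 \<le> w $ i" using v w by (auto simp: S_def)
    obtain f g where fg: "\<forall>x y. 0 < v $ (f x, g y, x, y)" using v by (auto simp: S_def)
    obtain f' g' where fg': "\<forall>x y. 0 < w $ (f' x, g' y, x, y)" using w by (auto simp: S_def)
    have "\<exists>f g. \<forall>x y. 0 < (1 - u) * v $ (f x, g y, x, y) + u * w $ (f x, g y, x, y)"
    proof (cases "u = 0")
      case True
      with fg show ?thesis by auto
    next
      case False
      with u nonneg fg' have "\<forall>x y. 0 < (1 - u) * v $ (f' x, g' y, x, y) + u * w $ (f' x, g' y, x, y)"
        by (intro allI add_nonneg_pos mult_nonneg_nonneg mult_pos_pos) auto
      then show ?thesis by blast
    qed
    then show "(1 - u) *\<^sub>R v + u *\<^sub>R w \<in> S"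
      using nonneg u by (auto simp: S_def)
  qed
  moreover have "vec_lambda (\<lambda>(a, b, x, y). p1 x a * p2 y b) \<in> S"
    if p1: "\<forall>x a. 0 \<le> p1 x a" "\<forall>x. (\<Sum>a\<in>UNIV. p1 x a) = 1"
      and p2: "\<forall>y b. 0 \<le> p2 y b" "\<forall>y. (\<Sum>b\<in>UNIV. p2 y b) = 1"
    for p1 :: "'x \<Rightarrow> 'a \<Rightarrow> real" and p2 :: "'y \<Rightarrow> 'b \<Rightarrow> real"
  proof -
    have "\<forall>x. \<exists>a. 0 < p1 x a" "\<forall>y. \<exists>b. 0 < p2 y b"
      by (intro allI exists_pos_of_sum_one; use p1 p2 in simp)+
    then obtain f g where "\<forall>x. 0 < p1 x (f x)" "\<forall>y. 0 < p2 y (g y)"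
      by metis
    then show ?thesis using p1 p2 by (auto simp: S_def intro!: exI[of _ f] exI[of _ g])
  qed
  ultimately have "local_correlations \<subseteq> S"
    unfolding local_correlations_def by (intro hull_minimal) auto
  with assms show ?thesis by (auto simp: S_def)
qed

lemma complex_cstar_simps:
  "carrier complex_cstar = UNIV" "\<one>\<^bsub>complex_cstar\<^esub> = 1" "\<zero>\<^bsub>complex_cstar\<^esub> = 0"
  "x \<otimes>\<^bsub>complex_cstar\<^esub> y = x * y" "x \<oplus>\<^bsub>complex_cstar\<^esub> y = x + y" "adj complex_cstar x = cnj x"
  by (simp_all add: complex_cstar_def)

lemma finsum_complex_cstar:
  assumes "finite S"
  shows "finsum complex_cstar f S = sum f S"
proof -
  interpret unital_cstar_algebra complex_cstar by (rule complex_cstar_unital_cstar_algebra)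
  from assms show ?thesis
    by (induction S rule: finite_induct) (simp_all add: complex_cstar_simps)
qed

lemma game_family_hom_image:
  assumes C: "unital_cstar_algebra C" and D: "unital_cstar_algebra D"
    and h: "h \<in> unital_star_hom C D" and fam: "game_family C lam p q"
  shows "game_family D lam (\<lambda>x a. h (p x a)) (\<lambda>y b. h (q y b))"
proof -
  interpret C: unital_cstar_algebra C by (rule C)
  interpret D: unital_cstar_algebra D by (rule D)
  have ring_hom: "h \<in> ring_hom C D" and adj: "\<forall>x\<in>carrier C. h (adj C x) = adj D (h x)"
    using h by (auto simp: unital_star_hom_def)
  interpret H: ring_hom_ring C D h
    by (rule ring_hom_ringI2[OF C.ring_axioms D.ring_axioms ring_hom])
  note fam = fam[unfolded game_family_def]
  have carr: "p x a \<in> carrier C" "q y b \<in> carrier C" for x a y b using fam by auto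
  have sums: "finsum D (\<lambda>a. h (p x a)) UNIV = \<one>\<^bsub>D\<^esub>" "finsum D (\<lambda>b. h (q y b)) UNIV = \<one>\<^bsub>D\<^esub>" for x y
    using H.hom_finsum[of "p x" UNIV] H.hom_finsum[of "q y" UNIV] fam carr
    by (simp_all add: comp_def)
  have mult: "h u \<otimes>\<^bsub>D\<^esub> h v = h (u \<otimes>\<^bsub>C\<^esub> v)" if "u \<in> carrier C" "v \<in> carrier C" for u v
    using that by simp
  have star: "adj D (h u) = h (adj C u)" if "u \<in> carrier C" for u
    using adj that by simp
  show ?thesis
    unfolding game_family_def
    using fam by (simp add: sums mult star carr del: H.hom_mult)
qed

lemma game_family_of_deterministic:
  assumes "\<forall>x y. lam x y (f x) (g y) \<noteq> 0"
  shows "game_family complex_cstar lam (\<lambda>x a. of_bool (a = f x)) (\<lambda>y b. of_bool (b = g y))"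
  using assms by (auto simp: game_family_def complex_cstar_simps finsum_complex_cstar of_bool_def)

text \<open>An idempotent scalar is 0 or 1, so taking real parts loses nothing and gives nonnegative
  numbers.\<close>

lemma perfect_local_strategy_of_scalar_family:
  assumes "game_family complex_cstar lam p q"
  shows "perfect_local_strategy lam (vec_lambda (\<lambda>(a, b, x, y). Re (p x a) * Re (q y b)))"
proof -
  note fam = assms[unfolded game_family_def complex_cstar_simps finsum_complex_cstar[OF finite]]
  have idem: "p x a = 0 \<or> p x a = 1" "q y b = 0 \<or> q y b = 1" for x a y b
    using fam by (metis mult_cancel_left2)+
  have nonneg: "0 \<le> Re (p x a)" "0 \<le> Re (q y b)" for x a y b
    using idem(1)[of x a] idem(2)[of y b] by auto
  have "(\<Sum>a\<in>UNIV. Re (p x a)) = 1" "(\<Sum>b\<in>UNIV. Re (q y b)) = 1" for x y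
    using fam by (simp_all flip: Re_sum)
  then have "vec_lambda (\<lambda>(a, b, x, y). Re (p x a) * Re (q y b)) \<in> local_correlations"
    unfolding local_correlations_def
    using nonneg
    by (intro hull_inc CollectI exI[of _ "\<lambda>x a. Re (p x a)"] exI[of _ "\<lambda>y b. Re (q y b)"]) auto
  moreover have "Re (p x a) * Re (q y b) = 0" if "lam x y a b = 0" for x y a b
    using fam that by (metis mult_eq_0_iff zero_complex.simps(1))
  ultimately show ?thesis by (simp add: perfect_local_strategy_def)
qed

theorem corollary5p7:
  fixes lam :: "('x::finite, 'y::finite, 'a::finite, 'b::finite) rule"
  assumes "imitation_game lam"
  shows "(\<exists>p. perfect_local_strategy lam p) \<longleftrightarrow>
         (\<exists>\<pi>. \<pi> \<in> unital_star_hom (game_cstar lam) complex_cstar)"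
proof
  assume "\<exists>p. perfect_local_strategy lam p"
  then obtain p where p: "p \<in> local_correlations"
      and perfect: "\<forall>x y a b. lam x y a b = 0 \<longrightarrow> p $ (a, b, x, y) = 0"
    by (auto simp: perfect_local_strategy_def)
  obtain f g where "\<forall>x y. 0 < p $ (f x, g y, x, y)"
    using local_correlation_charges_deterministic[OF p] by blast
  then have "\<forall>x y. lam x y (f x) (g y) \<noteq> 0"
    using perfect by (metis less_irrefl)
  then have "game_family complex_cstar lam (\<lambda>x a. of_bool (a = f x)) (\<lambda>y b. of_bool (b = g y))"
    by (rule game_family_of_deterministic)
  from game_cstar_universal[OF complex_cstar_unital_cstar_algebra this]
  show "\<exists>\<pi>. \<pi> \<in> unital_star_hom (game_cstar lam) complex_cstar" by blast
next
  assume "\<exists>\<pi>. \<pi> \<in> unital_star_hom (game_cstar lam) complex_cstar"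
  then obtain \<pi> where "\<pi> \<in> unital_star_hom (game_cstar lam) complex_cstar" by blast
  from game_family_hom_image[OF game_cstar_unital_cstar_algebra complex_cstar_unital_cstar_algebra
      this game_cstar_family]
  show "\<exists>p. perfect_local_strategy lam p"
    by (blast intro: perfect_local_strategy_of_scalar_family)
qed

end
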